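(* Let $n\ge 1$ and let ${}_{\mathcal L}\mathbf{SBA}_n$ be the free left-handed skew Boolean algebra on $\{x_1,\dots,x_n\}$. Then: (i) ${}_{\mathcal L}\mathbf{SBA}_n$ is a finite algebra whose atoms are the terms $(y_1\wedge\dots\wedge y_k)\setminus(y_{k+1}\vee\dots\vee y_n)$ where $1\le k\le n$ and $(y_1,\dots,y_n)$ is a permutation of $\{x_1,\dots,x_n\}$. (ii) Atoms $(y_1\wedge\dots\wedge y_k)\setminus(y_{k+1}\vee\dots\vee y_n)$ and $(z_1\wedge\dots\wedge z_l)\setminus(z_{l+1}\vee\dots\vee z_n)$ (both of the form in (i)) lie in the same atomic $\mathcal D$-class if and only if $k=l$, $(z_1,\dots,z_k)$ is a permutation of $\{y_1,\dots,y_k\}$ and thus $(z_{l+1},\dots,z_n)$ is a permutation of $\{y_{k+1},\dots,y_n\}$. (iii)$_{\mathcal L}$ $(y_1\wedge\dots\wedge y_k)\setminus(y_{k+1}\vee\dots\vee y_n)=(z_1\wedge\dots\wedge z_l)\setminus(z_{l+1}\vee\dots\vee z_n)$ if, besides the condition in (ii), $y_1=z_1$. For the free right-handed skew Boolean algebra ${}_{\mathcal R}\mathbf{SBA}_n$ on $\{x_1,\dots,x_n\}$, (i) and (ii) again hold (with ${}_{\mathcal R}\mathbf{SBA}_n$ in place of ${}_{\mathcal L}\mathbf{SBA}_n$) along with: (iii)$_{\mathcal R}$ $(y_1\wedge\dots\wedge y_k)\setminus(y_{k+1}\vee\dots\vee y_n)=(z_1\wedge\dots\wedge z_l)\setminus(z_{l+1}\vee\dots\vee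 z_n)$ if, in addition to the condition in (ii), $y_k=z_k$.
   Context: A skew lattice is an algebra $(S;\wedge,\vee)$ with associative binary operations satisfying $x\wedge(x\vee y)=x=(y\vee x)\wedge x$ and $x\vee(x\wedge y)=x=(y\wedge x)\vee x$. A skew Boolean algebra is an algebra $(S;\wedge,\vee,\setminus,0)$ such that $(S;\wedge,\vee)$ is a skew lattice satisfying $x\wedge(y\vee z)=(x\wedge y)\vee(x\wedge z)$ and $(x\vee y)\wedge z=(x\wedge z)\vee(y\wedge z)$, $0$ satisfies $0\wedge x=0=x\wedge 0$ and $0\vee x=x=x\vee 0$, and $(x\wedge y\wedge x)\vee(x\setminus y)=x$, $(x\wedge y\wedge x)\wedge(x\setminus y)=0=(x\setminus y)\wedge(x\wedge y\wedge x)$. It is left-handed if $x\wedge y\wedge x=x\wedge y$ and $x\vee y\vee x=y\vee x$ hold, right-handed if $x\wedge y\wedge x=y\wedge x$ and $x\vee y\vee x=x\vee y$ hold. Each of these classes is a variety, and free algebras are taken in the respective variety. Natural partial order: $x\ge y$ iff $x\wedge y=y=y\wedge x$. The congruence $\mathcal D$: $x\mathrel{\mathcal D}y$ iff $x\wedge y\wedge x=x$ and $y\wedge x\wedge y=y$; the quotient by $\mathcal D$ is a generalized Boolean algebra. An atom is a minimal nonzero element in the natural partial order. An atomic $\mathcal D$-class is a $\mathcal D$-class that is an atom of the quotient by $\mathcal D$. When $k=n$ the term $(y_1\wedge\dots\wedge y_k)\setminus(y_{k+1}\vee\dots\vee y_n)$ means $y_1\wedge\dots\wedge y_n$. *)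

theory Defs
  imports "HOL-Combinatorics.Multiset_Permutations"
begin

section \<open>Skew Boolean algebras\<close>

record 'a sba =
  carrier :: "'a set"
  meet :: "'a \<Rightarrow> 'a \<Rightarrow> 'a" (infixl "\<sqinter>\<index>" 70)
  join :: "'a \<Rightarrow> 'a \<Rightarrow> 'a" (infixl "\<squnion>\<index>" 65)
  diff :: "'a \<Rightarrow> 'a \<Rightarrow> 'a" (infixl "\<setminus>\<index>" 65)
  zero :: "'a" ("\<zero>\<index>")

locale sba_algebra =
  fixes S :: "'a sba" (structure)
  assumes meet_closed: "\<lbrakk>x \<in> carrier S; y \<in> carrier S\<rbrakk> \<Longrightarrow> x \<sqinter> y \<in> carrier S"
    and join_closed: "\<lbrakk>x \<in> carrier S; y \<in> carrier S\<rbrakk> \<Longrightarrow> x \<squnion> y \<in> carrier S"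
    and diff_closed: "\<lbrakk>x \<in> carrier S; y \<in> carrier S\<rbrakk> \<Longrightarrow> x \<setminus> y \<in> carrier S"
    and zero_closed: "\<zero> \<in> carrier S"

locale skew_boolean_algebra = sba_algebra +
  assumes meet_assoc:
      "\<lbrakk>x \<in> carrier S; y \<in> carrier S; z \<in> carrier S\<rbrakk> \<Longrightarrow> (x \<sqinter> y) \<sqinter> z = x \<sqinter> (y \<sqinter> z)"
    and join_assoc:
      "\<lbrakk>x \<in> carrier S; y \<in> carrier S; z \<in> carrier S\<rbrakk> \<Longrightarrow> (x \<squnion> y) \<squnion> z = x \<squnion> (y \<squnion> z)"
    and meet_join_absorb: "\<lbrakk>x \<in> carrier S; y \<in> carrier S\<rbrakk> \<Longrightarrow> x \<sqinter> (x \<squnion> y) = x"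
    and join_meet_absorb': "\<lbrakk>x \<in> carrier S; y \<in> carrier S\<rbrakk> \<Longrightarrow> (y \<squnion> x) \<sqinter> x = x"
    and join_meet_absorb: "\<lbrakk>x \<in> carrier S; y \<in> carrier S\<rbrakk> \<Longrightarrow> x \<squnion> (x \<sqinter> y) = x"
    and meet_join_absorb': "\<lbrakk>x \<in> carrier S; y \<in> carrier S\<rbrakk> \<Longrightarrow> (y \<sqinter> x) \<squnion> x = x"
    and meet_join_distrib:
      "\<lbrakk>x \<in> carrier S; y \<in> carrier S; z \<in> carrier S\<rbrakk>
        \<Longrightarrow> x \<sqinter> (y \<squnion> z) = (x \<sqinter> y) \<squnion> (x \<sqinter> z)"
    and join_meet_distrib:
      "\<lbrakk>x \<in> carrier S; y \<in> carrier S; z \<in> carrier S\<rbrakk>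
        \<Longrightarrow> (x \<squnion> y) \<sqinter> z = (x \<sqinter> z) \<squnion> (y \<sqinter> z)"
    and zero_meet: "x \<in> carrier S \<Longrightarrow> \<zero> \<sqinter> x = \<zero>"
    and meet_zero: "x \<in> carrier S \<Longrightarrow> x \<sqinter> \<zero> = \<zero>"
    and zero_join: "x \<in> carrier S \<Longrightarrow> \<zero> \<squnion> x = x"
    and join_zero: "x \<in> carrier S \<Longrightarrow> x \<squnion> \<zero> = x"
    and meet_join_diff:
      "\<lbrakk>x \<in> carrier S; y \<in> carrier S\<rbrakk> \<Longrightarrow> (x \<sqinter> y \<sqinter> x) \<squnion> (x \<setminus> y) = x"
    and meet_meet_diff:
      "\<lbrakk>x \<in> carrier S; y \<in> carrier S\<rbrakk> \<Longrightarrow> (x \<sqinter> y \<sqinter> x) \<sqinter> (x \<setminus> y) = \<zero>"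
    and diff_meet_meet:
      "\<lbrakk>x \<in> carrier S; y \<in> carrier S\<rbrakk> \<Longrightarrow> (x \<setminus> y) \<sqinter> (x \<sqinter> y \<sqinter> x) = \<zero>"

locale left_handed_sba = skew_boolean_algebra +
  assumes left_meet: "\<lbrakk>x \<in> carrier S; y \<in> carrier S\<rbrakk> \<Longrightarrow> x \<sqinter> y \<sqinter> x = x \<sqinter> y"
    and left_join: "\<lbrakk>x \<in> carrier S; y \<in> carrier S\<rbrakk> \<Longrightarrow> x \<squnion> y \<squnion> x = y \<squnion> x"

locale right_handed_sba = skew_boolean_algebra +
  assumes right_meet: "\<lbrakk>x \<in> carrier S; y \<in> carrier S\<rbrakk> \<Longrightarrow> x \<sqinter> y \<sqinter> x = y \<sqinter> x"
    and right_join: "\<lbrakk>x \<in> carrier S; y \<in> carrier S\<rbrakk> \<Longrightarrow> x \<squnion> y \<squnion> x = x \<squnion> y"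

section \<open>Congruences, quotients and homomorphisms\<close>

definition sba_congruence :: "'a sba \<Rightarrow> ('a \<times> 'a) set \<Rightarrow> bool" where
  "sba_congruence S \<theta> \<longleftrightarrow>
     equiv (carrier S) \<theta> \<and>
     (\<forall>(a, a') \<in> \<theta>. \<forall>(b, b') \<in> \<theta>.
        (meet S a b, meet S a' b') \<in> \<theta> \<and>
        (join S a b, join S a' b') \<in> \<theta> \<and>
        (diff S a b, diff S a' b') \<in> \<theta>)"

definition sba_quotient :: "'a sba \<Rightarrow> ('a \<times> 'a) set \<Rightarrow> 'a set sba" where
  "sba_quotient S \<theta> =
     \<lparr>carrier = carrier S // \<theta>,
      meet = (\<lambda>A B. \<Union>a\<in>A. \<Union>b\<in>B. \<theta> `` {meet S a b}),
      join = (\<lambda>A B. \<Union>a\<in>A. \<Union>b\<in>B. \<theta> `` {join S a b}),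
      diff = (\<lambda>A B. \<Union>a\<in>A. \<Union>b\<in>B. \<theta> `` {diff S a b}),
      zero = \<theta> `` {zero S}\<rparr>"

definition sba_hom :: "'a sba \<Rightarrow> 'b sba \<Rightarrow> ('a \<Rightarrow> 'b) set" where
  "sba_hom S T =
     {h. h \<in> carrier S \<rightarrow> carrier T \<and>
         (\<forall>a\<in>carrier S. \<forall>b\<in>carrier S.
            h (meet S a b) = meet T (h a) (h b) \<and>
            h (join S a b) = join T (h a) (h b) \<and>
            h (diff S a b) = diff T (h a) (h b)) \<and>
         h (zero S) = zero T}"

section \<open>Natural order, atoms and the relation \<open>\<D>\<close>\<close>

definition natural_le :: "'a sba \<Rightarrow> 'a \<Rightarrow> 'a \<Rightarrow> bool" where
  "natural_le S y x \<longleftrightarrow> meet S x y = y \<and> meet S y x = y"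

definition sba_atoms :: "'a sba \<Rightarrow> 'a set" where
  "sba_atoms S =
     {a \<in> carrier S. a \<noteq> zero S \<and>
        (\<forall>b\<in>carrier S. b \<noteq> zero S \<and> natural_le S b a \<longrightarrow> b = a)}"

definition D_rel :: "'a sba \<Rightarrow> ('a \<times> 'a) set" where
  "D_rel S =
     {(x, y). x \<in> carrier S \<and> y \<in> carrier S \<and>
        meet S (meet S x y) x = x \<and> meet S (meet S y x) y = y}"

definition atomic_D_classes :: "'a sba \<Rightarrow> 'a set set" where
  "atomic_D_classes S = sba_atoms (sba_quotient S (D_rel S))"

section \<open>Free algebras\<close>

datatype 'v sba_term =
    Var 'v
  | Zero
  | Meet "'v sba_term" "'v sba_term"
  | Join "'v sba_term" "'v sba_term"
  | Diff "'v sba_term" "'v sba_term"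

definition term_algebra :: "'v set \<Rightarrow> 'v sba_term sba" where
  "term_algebra X =
     \<lparr>carrier = {t. set_sba_term t \<subseteq> X}, meet = Meet, join = Join, diff = Diff, zero = Zero\<rparr>"

text \<open>
  The free algebra on \<open>X\<close> in a variety \<open>V\<close> is the term algebra modulo its least congruence
  whose quotient lies in \<open>V\<close>. HOL cannot quantify over algebras of all types inside a formula,
  so freeness is obtained by this construction. Membership in the variety and the
  universal property (for algebras of arbitrary type) are proved below.
\<close>

definition free_congruence ::
    "('v sba_term set sba \<Rightarrow> bool) \<Rightarrow> 'v set \<Rightarrow> ('v sba_term \<times> 'v sba_term) set" where
  "free_congruence V X =
     \<Inter>{\<theta>. sba_congruence (term_algebra X) \<theta> \<and> V (sba_quotient (term_algebra X) \<theta>)}"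

definition free_algebra ::
    "('v sba_term set sba \<Rightarrow> bool) \<Rightarrow> 'v set \<Rightarrow> 'v sba_term set sba" where
  "free_algebra V X = sba_quotient (term_algebra X) (free_congruence V X)"

definition free_gen ::
    "('v sba_term set sba \<Rightarrow> bool) \<Rightarrow> 'v set \<Rightarrow> 'v \<Rightarrow> 'v sba_term set" where
  "free_gen V X v = free_congruence V X `` {Var v}"

definition LSBA :: "nat \<Rightarrow> nat sba_term set sba" where
  "LSBA n = free_algebra left_handed_sba {1..n}"

definition LSBA_gens :: "nat \<Rightarrow> nat sba_term set set" where
  "LSBA_gens n = free_gen left_handed_sba {1..n} ` {1..n}"

definition RSBA :: "nat \<Rightarrow> nat sba_term set sba" where
  "RSBA n = free_algebra right_handed_sba {1..n}"

definition RSBA_gens :: "nat \<Rightarrow> nat sba_term set set" where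
  "RSBA_gens n = free_gen right_handed_sba {1..n} ` {1..n}"

section \<open>The terms \<open>(y\<^sub>1 \<and> \<dots> \<and> y\<^sub>k) \<setminus> (y\<^sub>k\<^sub>+\<^sub>1 \<or> \<dots> \<or> y\<^sub>n)\<close>\<close>

text \<open>The next two are meant for nonempty lists only.\<close>

definition list_meet :: "'a sba \<Rightarrow> 'a list \<Rightarrow> 'a" where
  "list_meet S ys = foldl (meet S) (hd ys) (tl ys)"

definition list_join :: "'a sba \<Rightarrow> 'a list \<Rightarrow> 'a" where
  "list_join S ys = foldl (join S) (hd ys) (tl ys)"

definition atom_term :: "'a sba \<Rightarrow> 'a list \<Rightarrow> nat \<Rightarrow> 'a" where
  "atom_term S ys k =
     (if k = length ys then list_meet S ys
      else diff S (list_meet S (take k ys)) (list_join S (drop k ys)))"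

section \<open>The construction yields free algebras\<close>

lemma sba_hom_eqI:
  assumes "\<exists>T h. P T \<and> h \<in> sba_hom S T \<and> h a \<noteq> h b \<or> a = b"
    and "\<And>T h. \<lbrakk>P T; h ` carrier S \<subseteq> carrier T;
           \<And>x y. x \<in> carrier S \<Longrightarrow> y \<in> carrier S \<Longrightarrow> h (meet S x y) = meet T (h x) (h y);
           \<And>x y. x \<in> carrier S \<Longrightarrow> y \<in> carrier S \<Longrightarrow> h (join S x y) = join T (h x) (h y);
           \<And>x y. x \<in> carrier S \<Longrightarrow> y \<in> carrier S \<Longrightarrow> h (diff S x y) = diff T (h x) (h y);
           h (zero S) = zero T; \<And>x. x \<in> carrier S \<Longrightarrow> h x \<in> carrier T\<rbrakk> \<Longrightarrow> h a = h b"
  shows "a = b"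
proof (rule ccontr)
  assume "a \<noteq> b"
  with assms(1) obtain T h where P: "P T" and h: "h \<in> sba_hom S T" and ne: "h a \<noteq> h b"
    by blast
  have "h a = h b"
    using h by (intro assms(2)[OF P]) (auto simp: sba_hom_def)
  with ne show False by contradiction
qed

lemma skew_boolean_algebra_separated:
  assumes "sba_algebra S"
    and sep: "\<And>a b. \<lbrakk>a \<in> carrier S; b \<in> carrier S; a \<noteq> b\<rbrakk>
           \<Longrightarrow> \<exists>(T :: 'b sba) h. skew_boolean_algebra T \<and> h \<in> sba_hom S T \<and> h a \<noteq> h b"
  shows "skew_boolean_algebra S"
proof -
  interpret S: sba_algebra S by fact
  note cl = S.meet_closed S.join_closed S.diff_closed S.zero_closed
  note ex = sba_hom_eqI[where P = skew_boolean_algebra and S = S]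
  have sep': "\<exists>(T :: 'b sba) h. skew_boolean_algebra T \<and> h \<in> sba_hom S T \<and> h a \<noteq> h b \<or> a = b"
    if "a \<in> carrier S" "b \<in> carrier S" for a b
    using sep[OF that] by blast
  show ?thesis
    apply unfold_locales
    subgoal by (rule ex, rule sep', (simp add: cl; fail)+,
      simp add: cl skew_boolean_algebra.meet_assoc)
    subgoal by (rule ex, rule sep', (simp add: cl; fail)+,
      simp add: cl skew_boolean_algebra.join_assoc)
    subgoal by (rule ex, rule sep', (simp add: cl; fail)+,
      simp add: cl skew_boolean_algebra.meet_join_absorb)
    subgoal by (rule ex, rule sep', (simp add: cl; fail)+,
      simp add: cl skew_boolean_algebra.join_meet_absorb')
    subgoal by (rule ex, rule sep', (simp add: cl; fail)+,
      simp add: cl skew_boolean_algebra.join_meet_absorb)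
    subgoal by (rule ex, rule sep', (simp add: cl; fail)+,
      simp add: cl skew_boolean_algebra.meet_join_absorb')
    subgoal by (rule ex, rule sep', (simp add: cl; fail)+,
      simp add: cl skew_boolean_algebra.meet_join_distrib)
    subgoal by (rule ex, rule sep', (simp add: cl; fail)+,
      simp add: cl skew_boolean_algebra.join_meet_distrib)
    subgoal by (rule ex, rule sep', (simp add: cl; fail)+,
      simp add: cl skew_boolean_algebra.zero_meet)
    subgoal by (rule ex, rule sep', (simp add: cl; fail)+,
      simp add: cl skew_boolean_algebra.meet_zero)
    subgoal by (rule ex, rule sep', (simp add: cl; fail)+,
      simp add: cl skew_boolean_algebra.zero_join)
    subgoal by (rule ex, rule sep', (simp add: cl; fail)+,
      simp add: cl skew_boolean_algebra.join_zero)
    subgoal by (rule ex, rule sep', (simp add: cl; fail)+,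
      simp add: cl skew_boolean_algebra.meet_join_diff)
    subgoal by (rule ex, rule sep', (simp add: cl; fail)+,
      simp add: cl skew_boolean_algebra.meet_meet_diff)
    subgoal by (rule ex, rule sep', (simp add: cl; fail)+,
      simp add: cl skew_boolean_algebra.diff_meet_meet)
    done
qed

lemma left_handed_sba_separated:
  assumes "sba_algebra S"
    and sep: "\<forall>a\<in>carrier S. \<forall>b\<in>carrier S. a \<noteq> b \<longrightarrow>
      (\<exists>(T :: 'b sba) h. left_handed_sba T \<and> h \<in> sba_hom S T \<and> h a \<noteq> h b)"
  shows "left_handed_sba S"
proof -
  interpret S: skew_boolean_algebra S
    using assms(1) by (rule skew_boolean_algebra_separated) (use sep left_handed_sba.axioms(1) in blast)
  note cl = S.meet_closed S.join_closed S.diff_closed S.zero_closed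
  note ex = sba_hom_eqI[where P = left_handed_sba and S = S]
  have sep': "\<exists>(T :: 'b sba) h. left_handed_sba T \<and> h \<in> sba_hom S T \<and> h a \<noteq> h b \<or> a = b"
    if "a \<in> carrier S" "b \<in> carrier S" for a b
    using sep that by blast
  show ?thesis
    by unfold_locales
      (rule ex, rule sep', simp add: cl, simp add: cl,
        simp add: cl left_handed_sba_def left_handed_sba_axioms_def)+
qed

lemma right_handed_sba_separated:
  assumes "sba_algebra S"
    and sep: "\<forall>a\<in>carrier S. \<forall>b\<in>carrier S. a \<noteq> b \<longrightarrow>
      (\<exists>(T :: 'b sba) h. right_handed_sba T \<and> h \<in> sba_hom S T \<and> h a \<noteq> h b)"
  shows "right_handed_sba S"
proof -
  interpret S: skew_boolean_algebra S
    using assms(1) by (rule skew_boolean_algebra_separated) (use sep right_handed_sba.axioms(1) in blast)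
  note cl = S.meet_closed S.join_closed S.diff_closed S.zero_closed
  note ex = sba_hom_eqI[where P = right_handed_sba and S = S]
  have sep': "\<exists>(T :: 'b sba) h. right_handed_sba T \<and> h \<in> sba_hom S T \<and> h a \<noteq> h b \<or> a = b"
    if "a \<in> carrier S" "b \<in> carrier S" for a b
    using sep that by blast
  show ?thesis
    by unfold_locales
      (rule ex, rule sep', simp add: cl, simp add: cl,
        simp add: cl right_handed_sba_def right_handed_sba_axioms_def)+
qed


lemma sba_congruenceD:
  assumes "sba_congruence S \<theta>"
  shows "equiv (carrier S) \<theta>"
    and "(a, a') \<in> \<theta> \<Longrightarrow> (b, b') \<in> \<theta> \<Longrightarrow> (meet S a b, meet S a' b') \<in> \<theta>"
    and "(a, a') \<in> \<theta> \<Longrightarrow> (b, b') \<in> \<theta> \<Longrightarrow> (join S a b, join S a' b') \<in> \<theta>"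
    and "(a, a') \<in> \<theta> \<Longrightarrow> (b, b') \<in> \<theta> \<Longrightarrow> (diff S a b, diff S a' b') \<in> \<theta>"
  using assms unfolding sba_congruence_def by blast+

lemma sba_quotient_ops:
  assumes c: "sba_congruence S \<theta>" and ab: "a \<in> carrier S" "b \<in> carrier S"
  shows "meet (sba_quotient S \<theta>) (\<theta> `` {a}) (\<theta> `` {b}) = \<theta> `` {meet S a b}"
    and "join (sba_quotient S \<theta>) (\<theta> `` {a}) (\<theta> `` {b}) = \<theta> `` {join S a b}"
    and "diff (sba_quotient S \<theta>) (\<theta> `` {a}) (\<theta> `` {b}) = \<theta> `` {diff S a b}"
proof -
  note eq = sba_congruenceD(1)[OF c]
  have cong: "congruent2 \<theta> \<theta> (\<lambda>a b. \<theta> `` {f a b})"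
    if "\<And>a a' b b'. (a, a') \<in> \<theta> \<Longrightarrow> (b, b') \<in> \<theta> \<Longrightarrow> (f a b, f a' b') \<in> \<theta>" for f
    using that by (auto simp: congruent2_def intro!: equiv_class_eq[OF eq])
  show "meet (sba_quotient S \<theta>) (\<theta> `` {a}) (\<theta> `` {b}) = \<theta> `` {meet S a b}"
    "join (sba_quotient S \<theta>) (\<theta> `` {a}) (\<theta> `` {b}) = \<theta> `` {join S a b}"
    "diff (sba_quotient S \<theta>) (\<theta> `` {a}) (\<theta> `` {b}) = \<theta> `` {diff S a b}"
    by (simp_all add: sba_quotient_def
        UN_equiv_class2[OF eq eq cong ab, OF sba_congruenceD(2)[OF c]]
        UN_equiv_class2[OF eq eq cong ab, OF sba_congruenceD(3)[OF c]]
        UN_equiv_class2[OF eq eq cong ab, OF sba_congruenceD(4)[OF c]])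
qed

lemma sba_algebra_quotient:
  assumes "sba_algebra S" and c: "sba_congruence S \<theta>"
  shows "sba_algebra (sba_quotient S \<theta>)"
proof -
  interpret sba_algebra S by fact
  have car: "carrier (sba_quotient S \<theta>) = carrier S // \<theta>"
    and z: "zero (sba_quotient S \<theta>) = \<theta> `` {zero S}"
    by (simp_all add: sba_quotient_def)
  show ?thesis
    by unfold_locales
      (auto simp: car z sba_quotient_ops[OF c] elim!: quotientE
        intro!: quotientI meet_closed join_closed diff_closed zero_closed)
qed

lemma sba_algebra_term_algebra: "sba_algebra (term_algebra X)"
  by unfold_locales (auto simp: term_algebra_def)

lemma free_congruence_congruence:
  fixes V :: "'v sba_term set sba \<Rightarrow> bool"
  assumes sepV: "\<And>S. \<lbrakk>sba_algebra S; \<forall>a\<in>carrier S. \<forall>b\<in>carrier S. a \<noteq> b \<longrightarrow>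
      (\<exists>(T :: 'v sba_term set sba) h. V T \<and> h \<in> sba_hom S T \<and> h a \<noteq> h b)\<rbrakk> \<Longrightarrow> V S"
  shows "sba_congruence (term_algebra X) (free_congruence V X)"
proof -
  define T where "T = term_algebra X"
  interpret T: sba_algebra T
    by (simp add: T_def sba_algebra_term_algebra)
  define F where "F = {\<theta>. sba_congruence T \<theta> \<and> V (sba_quotient T \<theta>)}"
  let ?U = "carrier T \<times> carrier T"
  have U: "sba_congruence T ?U"
    by (auto simp: sba_congruence_def equiv_def refl_on_def sym_def trans_def
        T.meet_closed T.join_closed T.diff_closed)
  have "V (sba_quotient T ?U)"
  proof (rule sepV; (intro ballI impI)?)
    show "sba_algebra (sba_quotient T ?U)"
      by (intro sba_algebra_quotient U) unfold_locales
    fix a b assume "a \<in> carrier (sba_quotient T ?U)" "b \<in> carrier (sba_quotient T ?U)" "a \<noteq> b"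
    then have False
      by (auto simp: sba_quotient_def quotient_def)
    then show "\<exists>T' h. V T' \<and> h \<in> sba_hom (sba_quotient T ?U) T' \<and> h a \<noteq> h b" ..
  qed
  with U have ne: "F \<noteq> {}" by (auto simp: F_def)
  have F: "equiv (carrier T) \<theta>" "sba_congruence T \<theta>" if "\<theta> \<in> F" for \<theta>
    using that by (auto simp: F_def sba_congruence_def)
  have "equiv (carrier T) (\<Inter>F)"
  proof (rule equivI)
    show "\<Inter>F \<subseteq> carrier T \<times> carrier T"
      using ne F(1) by (auto simp: equiv_def)
    show "refl_on (carrier T) (\<Inter>F)"
      using ne F(1) by (fastforce simp: equiv_def refl_on_def)
    show "sym (\<Inter>F)"
      using F(1) by (auto simp: equiv_def intro!: symI dest: symD)
    show "trans (\<Inter>F)"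
      unfolding trans_def using F(1) unfolding equiv_def trans_def by blast
  qed
  then have "sba_congruence T (\<Inter>F)"
    unfolding sba_congruence_def by (auto intro: sba_congruenceD[OF F(2)])
  then show ?thesis
    by (simp add: F_def T_def free_congruence_def)
qed

lemma free_algebra_in_variety:
  fixes V :: "'v sba_term set sba \<Rightarrow> bool"
  assumes sepV: "\<And>S. \<lbrakk>sba_algebra S; \<forall>a\<in>carrier S. \<forall>b\<in>carrier S. a \<noteq> b \<longrightarrow>
      (\<exists>(T :: 'v sba_term set sba) h. V T \<and> h \<in> sba_hom S T \<and> h a \<noteq> h b)\<rbrakk> \<Longrightarrow> V S"
  shows "V (free_algebra V X)"
proof -
  define T where "T = term_algebra X"
  define \<phi> where "\<phi> = free_congruence V X"
  interpret T: sba_algebra T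
    by (simp add: T_def sba_algebra_term_algebra)
  have \<phi>: "sba_congruence T \<phi>"
    unfolding T_def \<phi>_def by (rule free_congruence_congruence[OF sepV])
  note eq\<phi> = sba_congruenceD(1)[OF \<phi>]
  have "V (sba_quotient T \<phi>)"
  proof (rule sepV; (intro ballI impI)?)
    show "sba_algebra (sba_quotient T \<phi>)"
      by (intro sba_algebra_quotient \<phi>) unfold_locales
    fix A B assume A: "A \<in> carrier (sba_quotient T \<phi>)" and B: "B \<in> carrier (sba_quotient T \<phi>)"
      and "A \<noteq> B"
    obtain a b where ab: "a \<in> carrier T" "b \<in> carrier T" "A = \<phi> `` {a}" "B = \<phi> `` {b}"
      using A B by (auto simp: sba_quotient_def elim!: quotientE)
    with \<open>A \<noteq> B\<close> have "(a, b) \<notin> \<phi>"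
      using equiv_class_eq[OF eq\<phi>] by blast
    then obtain \<theta> where \<theta>: "sba_congruence T \<theta>" and V: "V (sba_quotient T \<theta>)"
      and nab: "(a, b) \<notin> \<theta>"
      by (auto simp: \<phi>_def T_def free_congruence_def)
    note eq\<theta> = sba_congruenceD(1)[OF \<theta>]
    have sub: "\<phi> \<subseteq> \<theta>"
      using \<theta> V by (auto simp: \<phi>_def T_def free_congruence_def)
    have img: "\<theta> `` (\<phi> `` {c}) = \<theta> `` {c}" if "c \<in> carrier T" for c
    proof
      show "\<theta> `` (\<phi> `` {c}) \<subseteq> \<theta> `` {c}"
        using sub eq\<theta> unfolding equiv_def trans_def by blast
      show "\<theta> `` {c} \<subseteq> \<theta> `` (\<phi> `` {c})"
        using equiv_class_self[OF eq\<phi> that] by blast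
    qed
    have "(\<lambda>C. \<theta> `` C) \<in> sba_hom (sba_quotient T \<phi>) (sba_quotient T \<theta>)"
    proof -
      have *: "carrier (sba_quotient T \<psi>) = carrier T // \<psi>"
        "zero (sba_quotient T \<psi>) = \<psi> `` {zero T}" for \<psi>
        by (simp_all add: sba_quotient_def)
      show ?thesis
        unfolding sba_hom_def *
        by (intro CollectI conjI ballI Pi_I; (elim quotientE)?; hypsubst?;
            simp add: img sba_quotient_ops[OF \<theta>] sba_quotient_ops[OF \<phi>] T.meet_closed
              T.join_closed T.diff_closed T.zero_closed quotientI)
    qed
    moreover have "\<theta> `` A \<noteq> \<theta> `` B"
      using ab img nab eq_equiv_class[OF _ eq\<theta>, of a b] by auto
    ultimately show "\<exists>T' h. V T' \<and> h \<in> sba_hom (sba_quotient T \<phi>) T' \<and> h A \<noteq> h B"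
      using V by blast
  qed
  then show ?thesis
    by (simp add: T_def \<phi>_def free_algebra_def)
qed

primrec sba_eval :: "'a sba \<Rightarrow> ('v \<Rightarrow> 'a) \<Rightarrow> 'v sba_term \<Rightarrow> 'a" where
  "sba_eval S f (Var v) = f v"
| "sba_eval S f Zero = zero S"
| "sba_eval S f (Meet s t) = meet S (sba_eval S f s) (sba_eval S f t)"
| "sba_eval S f (Join s t) = join S (sba_eval S f s) (sba_eval S f t)"
| "sba_eval S f (Diff s t) = diff S (sba_eval S f s) (sba_eval S f t)"

lemma free_algebra_extends:
  fixes V :: "'v sba_term set sba \<Rightarrow> bool" and S :: "'a sba"
  assumes S: "sba_algebra S" and f: "\<And>v. v \<in> X \<Longrightarrow> f v \<in> carrier S"
    and cong: "sba_congruence (term_algebra X) (free_congruence V X)"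
    and embed: "\<And>(Q :: 'v sba_term set sba) h.
      \<lbrakk>sba_algebra Q; h \<in> sba_hom Q S; inj_on h (carrier Q)\<rbrakk> \<Longrightarrow> V Q"
  shows "\<exists>h \<in> sba_hom (free_algebra V X) S. \<forall>v\<in>X. h (free_gen V X v) = f v"
proof -
  define T where "T = term_algebra X"
  interpret S: sba_algebra S by fact
  interpret T: sba_algebra T
    by (simp add: T_def sba_algebra_term_algebra)
  let ?e = "sba_eval S f"
  have e: "?e t \<in> carrier S" if "t \<in> carrier T" for t
    using that by (induction t)
      (auto simp: T_def term_algebra_def f S.meet_closed S.join_closed S.diff_closed S.zero_closed)
  have ops: "?e (meet T s t) = meet S (?e s) (?e t)" "?e (join T s t) = join S (?e s) (?e t)"
    "?e (diff T s t) = diff S (?e s) (?e t)" "?e (zero T) = zero S" for s t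
    by (simp_all add: T_def term_algebra_def)
  define \<kappa> where "\<kappa> = {(s, t). s \<in> carrier T \<and> t \<in> carrier T \<and> ?e s = ?e t}"
  have \<kappa>: "sba_congruence T \<kappa>"
    by (auto simp: sba_congruence_def \<kappa>_def equiv_def refl_on_def sym_def trans_def
        T.meet_closed T.join_closed T.diff_closed ops)
  define h where "h C = the_elem (?e ` C)" for C
  have h: "h (\<psi> `` {t}) = ?e t" if "t \<in> carrier T" "equiv (carrier T) \<psi>" "\<psi> \<subseteq> \<kappa>" for \<psi> t
  proof -
    have "?e ` (\<psi> `` {t}) = {?e t}"
      using that by (fastforce simp: \<kappa>_def equiv_def refl_on_def)
    then show ?thesis by (simp add: h_def)
  qed
  have hom: "h \<in> sba_hom (sba_quotient T \<psi>) S" if \<psi>: "sba_congruence T \<psi>" "\<psi> \<subseteq> \<kappa>" for \<psi>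
  proof -
    have *: "carrier (sba_quotient T \<psi>) = carrier T // \<psi>"
      "zero (sba_quotient T \<psi>) = \<psi> `` {zero T}"
      by (simp_all add: sba_quotient_def)
    show ?thesis
      unfolding sba_hom_def *
      by (intro CollectI conjI ballI Pi_I; (elim quotientE)?; hypsubst?;
          simp add: h[OF _ sba_congruenceD(1)[OF \<psi>(1)] \<psi>(2)] sba_quotient_ops[OF \<psi>(1)]
            T.meet_closed T.join_closed T.diff_closed T.zero_closed ops e)
  qed
  have "V (sba_quotient T \<kappa>)"
  proof (rule embed[OF _ hom[OF \<kappa>]])
    show "sba_algebra (sba_quotient T \<kappa>)"
      by (intro sba_algebra_quotient \<kappa>) unfold_locales
    show "inj_on h (carrier (sba_quotient T \<kappa>))"
    proof (rule inj_onI)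
      fix A B assume "A \<in> carrier (sba_quotient T \<kappa>)" "B \<in> carrier (sba_quotient T \<kappa>)"
        and hAB: "h A = h B"
      then obtain a b where ab: "a \<in> carrier T" "b \<in> carrier T" "A = \<kappa> `` {a}" "B = \<kappa> `` {b}"
        by (auto simp: sba_quotient_def elim!: quotientE)
      have "(a, b) \<in> \<kappa>"
        using ab hAB h[OF _ sba_congruenceD(1)[OF \<kappa>]] by (auto simp: \<kappa>_def)
      then show "A = B"
        using ab equiv_class_eq[OF sba_congruenceD(1)[OF \<kappa>]] by blast
    qed
  qed simp
  then have sub: "free_congruence V X \<subseteq> \<kappa>"
    using \<kappa> by (auto simp: free_congruence_def T_def)
  have cong': "sba_congruence T (free_congruence V X)"
    using cong by (simp add: T_def)
  show ?thesis
  proof (intro bexI ballI)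
    show "h \<in> sba_hom (free_algebra V X) S"
      using hom[OF cong' sub] by (simp add: free_algebra_def T_def)
    fix v assume "v \<in> X"
    then show "h (free_gen V X v) = f v"
      using h[OF _ sba_congruenceD(1)[OF cong'] sub, of "Var v"]
      by (simp add: free_gen_def T_def term_algebra_def)
  qed
qed

lemma free_algebra_generated:
  fixes V :: "'v sba_term set sba \<Rightarrow> bool"
  assumes c: "sba_congruence (term_algebra X) (free_congruence V X)"
    and g: "g \<in> sba_hom (free_algebra V X) S" and h: "h \<in> sba_hom (free_algebra V X) S"
    and gens: "\<And>v. v \<in> X \<Longrightarrow> g (free_gen V X v) = h (free_gen V X v)"
    and C: "C \<in> carrier (free_algebra V X)"
  shows "g C = h C"
proof -
  let ?\<phi> = "free_congruence V X" and ?T = "term_algebra X" and ?F = "free_algebra V X"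
  have F: "carrier ?F = carrier ?T // ?\<phi>" "zero ?F = ?\<phi> `` {zero ?T}"
    by (simp_all add: free_algebra_def sba_quotient_def)
  have in_F: "?\<phi> `` {t} \<in> carrier ?F" if "t \<in> carrier ?T" for t
    using that by (simp add: F quotientI)
  note ops = sba_quotient_ops[OF c, folded free_algebra_def, symmetric]
  have "g (?\<phi> `` {t}) = h (?\<phi> `` {t})" if "t \<in> carrier ?T" for t
    using that
  proof (induction t)
    case (Var v) then show ?case
      using gens[of v] by (simp add: free_gen_def term_algebra_def)
  next
    case Zero
    have "zero ?T = Zero" by (simp add: term_algebra_def)
    then show ?case using g h F(2) by (auto simp: sba_hom_def)
  next
    case (Meet s t)
    then have st: "s \<in> carrier ?T" "t \<in> carrier ?T" by (auto simp: term_algebra_def)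
    have "Meet s t = meet ?T s t" by (simp add: term_algebra_def)
    with Meet.IH st in_F[OF st(1)] in_F[OF st(2)] g h show ?case
      by (simp add: ops(1) sba_hom_def)
  next
    case (Join s t)
    then have st: "s \<in> carrier ?T" "t \<in> carrier ?T" by (auto simp: term_algebra_def)
    have "Join s t = join ?T s t" by (simp add: term_algebra_def)
    with Join.IH st in_F[OF st(1)] in_F[OF st(2)] g h show ?case
      by (simp add: ops(2) sba_hom_def)
  next
    case (Diff s t)
    then have st: "s \<in> carrier ?T" "t \<in> carrier ?T" by (auto simp: term_algebra_def)
    have "Diff s t = diff ?T s t" by (simp add: term_algebra_def)
    with Diff.IH st in_F[OF st(1)] in_F[OF st(2)] g h show ?case
      by (simp add: ops(3) sba_hom_def)
  qed
  with C show ?thesis by (auto simp: F elim!: quotientE)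
qed

theorem left_handed_sba_free_algebra: "left_handed_sba (free_algebra left_handed_sba X)"
  by (rule free_algebra_in_variety) (rule left_handed_sba_separated)

theorem right_handed_sba_free_algebra: "right_handed_sba (free_algebra right_handed_sba X)"
  by (rule free_algebra_in_variety) (rule right_handed_sba_separated)

theorem left_handed_universal_property:
  fixes X :: "'a set" and S :: "'b sba"
  assumes S: "left_handed_sba S" and f: "\<And>v. v \<in> X \<Longrightarrow> f v \<in> carrier S"
  shows "\<exists>h \<in> sba_hom (free_algebra left_handed_sba X) S.
           (\<forall>v\<in>X. h (free_gen left_handed_sba X v) = f v) \<and>
           (\<forall>g \<in> sba_hom (free_algebra left_handed_sba X) S.
              (\<forall>v\<in>X. g (free_gen left_handed_sba X v) = f v) \<longrightarrow>
              (\<forall>C \<in> carrier (free_algebra left_handed_sba X). g C = h C))"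
proof -
  interpret S: left_handed_sba S by fact
  have c: "sba_congruence (term_algebra X) (free_congruence left_handed_sba X)"
    by (rule free_congruence_congruence) (rule left_handed_sba_separated)
  have "\<exists>h \<in> sba_hom (free_algebra left_handed_sba X) S.
          \<forall>v\<in>X. h (free_gen left_handed_sba X v) = f v"
  proof (rule free_algebra_extends[OF S.sba_algebra_axioms f c])
    fix Q :: "'a sba_term set sba" and h
    assume "sba_algebra Q" "h \<in> sba_hom Q S" "inj_on h (carrier Q)"
    then show "left_handed_sba Q"
      using S by (intro left_handed_sba_separated[where 'b = 'b]) (assumption, blast dest: inj_onD)
  qed
  then obtain h where h: "h \<in> sba_hom (free_algebra left_handed_sba X) S"
    and hf: "\<forall>v\<in>X. h (free_gen left_handed_sba X v) = f v" ..
  show ?thesis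
  proof (intro bexI[OF _ h] conjI hf ballI impI)
    fix g C assume "g \<in> sba_hom (free_algebra left_handed_sba X) S"
      and "\<forall>v\<in>X. g (free_gen left_handed_sba X v) = f v"
      and "C \<in> carrier (free_algebra left_handed_sba X)"
    then show "g C = h C"
      using free_algebra_generated[OF c _ h, of g C] hf by simp
  qed
qed

theorem right_handed_universal_property:
  fixes X :: "'a set" and S :: "'b sba"
  assumes S: "right_handed_sba S" and f: "\<And>v. v \<in> X \<Longrightarrow> f v \<in> carrier S"
  shows "\<exists>h \<in> sba_hom (free_algebra right_handed_sba X) S.
           (\<forall>v\<in>X. h (free_gen right_handed_sba X v) = f v) \<and>
           (\<forall>g \<in> sba_hom (free_algebra right_handed_sba X) S.
              (\<forall>v\<in>X. g (free_gen right_handed_sba X v) = f v) \<longrightarrow>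
              (\<forall>C \<in> carrier (free_algebra right_handed_sba X). g C = h C))"
proof -
  interpret S: right_handed_sba S by fact
  have c: "sba_congruence (term_algebra X) (free_congruence right_handed_sba X)"
    by (rule free_congruence_congruence) (rule right_handed_sba_separated)
  have "\<exists>h \<in> sba_hom (free_algebra right_handed_sba X) S.
          \<forall>v\<in>X. h (free_gen right_handed_sba X v) = f v"
  proof (rule free_algebra_extends[OF S.sba_algebra_axioms f c])
    fix Q :: "'a sba_term set sba" and h
    assume "sba_algebra Q" "h \<in> sba_hom Q S" "inj_on h (carrier Q)"
    then show "right_handed_sba Q"
      using S by (intro right_handed_sba_separated[where 'b = 'b]) (assumption, blast dest: inj_onD)
  qed
  then obtain h where h: "h \<in> sba_hom (free_algebra right_handed_sba X) S"
    and hf: "\<forall>v\<in>X. h (free_gen right_handed_sba X v) = f v" ..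
  show ?thesis
  proof (intro bexI[OF _ h] conjI hf ballI impI)
    fix g C assume "g \<in> sba_hom (free_algebra right_handed_sba X) S"
      and "\<forall>v\<in>X. g (free_gen right_handed_sba X v) = f v"
      and "C \<in> carrier (free_algebra right_handed_sba X)"
    then show "g C = h C"
      using free_algebra_generated[OF c _ h, of g C] hf by simp
  qed
qed

theorem inj_on_free_gen_left: "inj_on (free_gen left_handed_sba X) X"
proof (rule inj_onI)
  fix v w assume vw: "v \<in> X" "w \<in> X"
    and eq: "free_gen left_handed_sba X v = free_gen left_handed_sba X w"
  let ?B = "\<lparr>carrier = UNIV, meet = (\<and>), join = (\<or>), diff = (\<lambda>a b. a \<and> \<not> b), zero = False\<rparr>"
  have "left_handed_sba ?B"
    by unfold_locales auto
  then have "\<exists>h \<in> sba_hom (free_algebra left_handed_sba X) ?B.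
      (\<forall>u\<in>X. h (free_gen left_handed_sba X u) = (u = v)) \<and>
      (\<forall>g \<in> sba_hom (free_algebra left_handed_sba X) ?B.
         (\<forall>u\<in>X. g (free_gen left_handed_sba X u) = (u = v)) \<longrightarrow>
         (\<forall>C \<in> carrier (free_algebra left_handed_sba X). g C = h C))"
    by (rule left_handed_universal_property) simp
  then obtain h where "\<forall>u\<in>X. h (free_gen left_handed_sba X u) = (u = v)"
    by (elim bexE conjE)
  with vw eq show "v = w" by metis
qed

theorem inj_on_free_gen_right: "inj_on (free_gen right_handed_sba X) X"
proof (rule inj_onI)
  fix v w assume vw: "v \<in> X" "w \<in> X"
    and eq: "free_gen right_handed_sba X v = free_gen right_handed_sba X w"
  let ?B = "\<lparr>carrier = UNIV, meet = (\<and>), join = (\<or>), diff = (\<lambda>a b. a \<and> \<not> b), zero = False\<rparr>"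
  have "right_handed_sba ?B"
    by unfold_locales auto
  then have "\<exists>h \<in> sba_hom (free_algebra right_handed_sba X) ?B.
      (\<forall>u\<in>X. h (free_gen right_handed_sba X u) = (u = v)) \<and>
      (\<forall>g \<in> sba_hom (free_algebra right_handed_sba X) ?B.
         (\<forall>u\<in>X. g (free_gen right_handed_sba X u) = (u = v)) \<longrightarrow>
         (\<forall>C \<in> carrier (free_algebra right_handed_sba X). g C = h C))"
    by (rule right_handed_universal_property) simp
  then obtain h where "\<forall>u\<in>X. h (free_gen right_handed_sba X u) = (u = v)"
    by (elim bexE conjE)
  with vw eq show "v = w" by metis
qed

end

theory Submission
  imports Defs
begin

text \<open>
  For a set \<open>A\<close> let \<open>A\<^sup>0\<close> be the flat left-handed algebra on \<open>A\<close> and a zero, in which nonzero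
  elements satisfy \<open>a \<sqinter> b = a\<close>, \<open>a \<squnion> b = b\<close> and \<open>a \<setminus> b = 0\<close>. The free left-handed algebra on a
  finite set \<open>G\<close> is the product of the algebras \<open>A\<^sup>0\<close> over the nonempty \<open>A \<subseteq> G\<close>, the generator \<open>g\<close>
  being the tuple with entry \<open>g\<close> where \<open>g \<in> A\<close> and \<open>0\<close> elsewhere. The theorem can be read off
  from this: the atoms are the tuples with exactly one nonzero entry, say \<open>x\<close> at \<open>A\<close>; two of them
  are \<open>\<D>\<close>-related when they live at the same \<open>A\<close>; and \<open>(y\<^sub>1 \<and> \<dots> \<and> y\<^sub>k) \<setminus> (y\<^sub>k\<^sub>+\<^sub>1 \<or> \<dots> \<or> y\<^sub>n)\<close> is the
  one with \<open>A = {y\<^sub>1, \<dots>, y\<^sub>k}\<close> and \<open>x = y\<^sub>1\<close>.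

  Freeness supplies the coordinate homomorphisms \<open>val A\<close> into the flat algebras. What has to be
  shown is that they jointly separate points (\<open>val_separates\<close>). The term attached to \<open>A\<close> and \<open>x\<close>
  is \<open>cell A x\<close>; it depends on nothing else, because two \<open>\<D>\<close>-related elements below a common
  element are equal (\<open>D_related_below_eq\<close>). Induction over the generation of \<open>t\<close> shows that
  \<open>t \<sqinter> cell A x\<close> is the cell selected by \<open>val A t\<close>, or zero (\<open>meet_cell\<close>). Further, no nonzero
  element below a generator is killed by all cells (\<open>eq_zero_if_val_None\<close>): such an element could
  be cut along one generator after another until, for some \<open>A\<close>, a piece lies inside every
  generator of \<open>A\<close> and outside all others, hence inside a cell. So a join \<open>e\<close> of one cell for each
  \<open>A\<close> satisfies \<open>t \<sqinter> e = t\<close> for all \<open>t\<close>, while \<open>t \<sqinter> e\<close> is computed from the values \<open>val A t\<close>.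

  Exchanging the arguments of meet and join turns right-handed algebras into left-handed ones and
  reverses the meets and joins in the terms, so that the last of \<open>y\<^sub>1, \<dots>, y\<^sub>k\<close> takes over the role
  of the first.
\<close>

section \<open>Arithmetic of skew Boolean algebras\<close>

context skew_boolean_algebra
begin

lemmas closed [simp] = meet_closed join_closed diff_closed zero_closed

declare zero_meet [simp] meet_zero [simp] zero_join [simp] join_zero [simp]

lemma meet_idem [simp]: "x \<in> carrier S \<Longrightarrow> x \<sqinter> x = x"
  by (metis join_meet_absorb join_closed meet_closed meet_join_absorb)

lemma join_eq_zeroD:
  assumes "x \<in> carrier S" "y \<in> carrier S" "x \<squnion> y = \<zero>"
  shows "x = \<zero>" "y = \<zero>"
  using assms meet_join_absorb[of x y] join_meet_absorb'[of y x] by auto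

lemma meet_diff_self:
  assumes "x \<in> carrier S" "y \<in> carrier S"
  shows "x \<sqinter> (x \<setminus> y) = x \<setminus> y"
  using assms join_meet_absorb'[of "x \<setminus> y" "x \<sqinter> y \<sqinter> x"] by (simp add: meet_join_diff)

lemma diff_meet_self:
  assumes "x \<in> carrier S" "y \<in> carrier S"
  shows "(x \<setminus> y) \<sqinter> x = x \<setminus> y"
  using assms meet_join_distrib[of "x \<setminus> y" "x \<sqinter> y \<sqinter> x" "x \<setminus> y"]
  by (simp add: meet_join_diff diff_meet_meet)

text \<open>
  The axioms give the decomposition of \<open>x\<close> along \<open>y\<close> in one order only. Its two parts \<open>p\<close>, \<open>q\<close> have
  meet zero on both sides, and such elements commute under join: expand \<open>x \<sqinter> (q \<squnion> p)\<close> once as it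
  stands and once with \<open>x = p \<squnion> q\<close>.
\<close>
lemma diff_join_meet:
  assumes xy: "x \<in> carrier S" "y \<in> carrier S"
  shows "(x \<setminus> y) \<squnion> (x \<sqinter> y \<sqinter> x) = x"
proof -
  define p q where "p = x \<sqinter> y \<sqinter> x" and "q = x \<setminus> y"
  have [simp]: "p \<in> carrier S" "q \<in> carrier S"
    using xy by (simp_all add: p_def q_def)
  have x: "p \<squnion> q = x" and pq: "p \<sqinter> q = \<zero>" "q \<sqinter> p = \<zero>"
    using xy by (simp_all add: p_def q_def meet_join_diff meet_meet_diff diff_meet_meet)
  have "x \<sqinter> p = p"
    using meet_join_distrib[of x p q] join_meet_distrib[of p q p] x pq by simp
  moreover have "x \<sqinter> q = q"
    using xy by (simp add: q_def meet_diff_self)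
  ultimately have "q \<squnion> p = x \<sqinter> (q \<squnion> p)"
    using xy by (simp add: meet_join_distrib)
  also have "\<dots> = (p \<squnion> q) \<sqinter> (q \<squnion> p)"
    by (simp add: x)
  also have "\<dots> = (p \<sqinter> (q \<squnion> p)) \<squnion> (q \<sqinter> (q \<squnion> p))"
    by (intro join_meet_distrib) simp_all
  also have "\<dots> = p \<squnion> q"
    by (simp add: meet_join_distrib pq)
  also note x
  finally show ?thesis
    by (simp add: p_def q_def)
qed

lemma list_meet_snoc: "ys \<noteq> [] \<Longrightarrow> list_meet S (ys @ [y]) = list_meet S ys \<sqinter> y"
  by (simp add: list_meet_def)

lemma list_join_snoc: "ys \<noteq> [] \<Longrightarrow> list_join S (ys @ [y]) = list_join S ys \<squnion> y"
  by (simp add: list_join_def)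

lemma list_meet_closed [simp]:
  "ys \<noteq> [] \<Longrightarrow> set ys \<subseteq> carrier S \<Longrightarrow> list_meet S ys \<in> carrier S"
  by (induction ys rule: rev_nonempty_induct) (simp_all add: list_meet_snoc, simp add: list_meet_def)

lemma list_join_closed [simp]:
  "ys \<noteq> [] \<Longrightarrow> set ys \<subseteq> carrier S \<Longrightarrow> list_join S ys \<in> carrier S"
  by (induction ys rule: rev_nonempty_induct) (simp_all add: list_join_snoc, simp add: list_join_def)

end

context left_handed_sba
begin

lemma left_regular:
  "x \<in> carrier S \<Longrightarrow> y \<in> carrier S \<Longrightarrow> x \<sqinter> (y \<sqinter> x) = x \<sqinter> y"
  using left_meet[of x y] by (simp add: meet_assoc)

lemma meet_eq_zero_commute:
  assumes "x \<in> carrier S" "y \<in> carrier S" "x \<sqinter> y = \<zero>"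
  shows "y \<sqinter> x = \<zero>"
  using assms by (metis left_regular meet_zero)

text \<open>
  Disjointness from \<open>x\<close> is inherited by everything in a lower or equal \<open>\<D>\<close>-class, which is what
  \<open>y \<sqinter> x = y\<close> says in the left-handed case.
\<close>
lemma meet_eq_zero_trans:
  assumes "u \<in> carrier S" "x \<in> carrier S" "y \<in> carrier S"
    and "u \<sqinter> x = \<zero>" "y \<sqinter> x = y"
  shows "u \<sqinter> y = \<zero>"
proof -
  have "x \<sqinter> u = \<zero>"
    using assms by (auto intro: meet_eq_zero_commute[of u x])
  then have "y \<sqinter> u = \<zero>"
    using assms meet_assoc[of y x u] by simp
  then show ?thesis
    using assms by (auto intro: meet_eq_zero_commute[of y u])
qed

lemma join_meet_diff:
  "x \<in> carrier S \<Longrightarrow> y \<in> carrier S \<Longrightarrow> (x \<sqinter> y) \<squnion> (x \<setminus> y) = x"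
  using meet_join_diff[of x y] by (simp add: left_meet)

lemma diff_meet_subtrahend:
  assumes "x \<in> carrier S" "y \<in> carrier S"
  shows "(x \<setminus> y) \<sqinter> y = \<zero>"
proof -
  have "(x \<setminus> y) \<sqinter> y = (x \<setminus> y) \<sqinter> x \<sqinter> y"
    using assms by (simp add: diff_meet_self)
  also have "\<dots> = \<zero>"
    using assms diff_meet_meet[of x y] by (simp add: left_meet meet_assoc)
  finally show ?thesis .
qed

lemma meet_diff_absorb:
  assumes "u \<in> carrier S" "p \<in> carrier S" "q \<in> carrier S"
    and "u \<sqinter> p = u" "u \<sqinter> q = \<zero>"
  shows "u \<sqinter> (p \<setminus> q) = u"
proof -
  have "u = u \<sqinter> ((p \<sqinter> q) \<squnion> (p \<setminus> q))"
    using assms by (simp add: join_meet_diff)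
  also have "\<dots> = (u \<sqinter> p \<sqinter> q) \<squnion> (u \<sqinter> (p \<setminus> q))"
    using assms(1-3) by (simp add: meet_join_distrib meet_assoc)
  also have "\<dots> = u \<sqinter> (p \<setminus> q)"
    using assms by simp
  finally show ?thesis by simp
qed

text \<open>
  Two \<open>\<D>\<close>-related elements \<open>u\<close>, \<open>v\<close> below \<open>x\<close> coincide: in \<open>x = u \<squnion> (x \<setminus> u)\<close> the second part is
  disjoint from \<open>u\<close>, hence from \<open>v\<close>, so \<open>v = x \<sqinter> v = u \<sqinter> v = u\<close>. All identities between cells
  rest on this.
\<close>
lemma D_related_below_eq:
  assumes car: "x \<in> carrier S" "u \<in> carrier S" "v \<in> carrier S"
    and below: "x \<sqinter> u = u" "x \<sqinter> v = v"
    and D: "u \<sqinter> v = u" "v \<sqinter> u = v"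
  shows "u = v"
proof -
  have "(x \<setminus> u) \<sqinter> v = \<zero>"
    using car D diff_meet_subtrahend by (intro meet_eq_zero_trans[of "x \<setminus> u" u v]) auto
  moreover have "u \<squnion> (x \<setminus> u) = x"
    using car below join_meet_diff[of x u] by simp
  ultimately have "x \<sqinter> v = u"
    using car D join_meet_distrib[of u "x \<setminus> u" v] by simp
  with below show ?thesis by simp
qed

lemma natural_leI:
  "x \<in> carrier S \<Longrightarrow> y \<in> carrier S \<Longrightarrow> x \<sqinter> y = y \<Longrightarrow> natural_le S y x"
  unfolding natural_le_def by (metis left_meet)

lemma D_rel_iff:
  "(x, y) \<in> D_rel S \<longleftrightarrow>
     x \<in> carrier S \<and> y \<in> carrier S \<and> x \<sqinter> y = x \<and> y \<sqinter> x = y"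
  by (auto simp: D_rel_def left_meet)

text \<open>
  In a left regular band a factor repeated further to the right can be dropped.
\<close>
lemma list_meet_meet:
  "\<lbrakk>ys \<noteq> []; set ys \<subseteq> carrier S; x \<in> set ys\<rbrakk> \<Longrightarrow> list_meet S ys \<sqinter> x = list_meet S ys"
proof (induction ys rule: rev_nonempty_induct)
  case (single y)
  then show ?case by (simp add: list_meet_def)
next
  case (snoc y ys)
  let ?m = "list_meet S ys"
  have car: "?m \<in> carrier S" "x \<in> carrier S" "y \<in> carrier S"
    using snoc by auto
  show ?case
  proof (cases "x = y")
    case False
    then have m: "?m \<sqinter> x = ?m"
      using snoc by auto
    have "?m \<sqinter> y \<sqinter> x = (?m \<sqinter> x) \<sqinter> (y \<sqinter> x)"
      using car by (simp add: m meet_assoc)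
    also have "\<dots> = ?m \<sqinter> (x \<sqinter> (y \<sqinter> x))"
      using car by (simp add: meet_assoc)
    also have "\<dots> = ?m \<sqinter> x \<sqinter> y"
      using car by (simp add: left_regular meet_assoc)
    finally show ?thesis
      using snoc.hyps by (simp add: list_meet_snoc m)
  qed (use snoc.hyps car in \<open>simp add: list_meet_snoc meet_assoc\<close>)
qed

lemma hd_meet_list_meet:
  "\<lbrakk>ys \<noteq> []; set ys \<subseteq> carrier S\<rbrakk> \<Longrightarrow> hd ys \<sqinter> list_meet S ys = list_meet S ys"
proof (induction ys rule: rev_nonempty_induct)
  case (single y)
  then show ?case by (simp add: list_meet_def)
next
  case (snoc y ys)
  then have "hd ys \<in> carrier S"
    by (auto simp: subset_iff)
  with snoc show ?case
    using meet_assoc[of "hd ys" "list_meet S ys" y] by (simp add: list_meet_snoc)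
qed

lemma meet_list_meet_absorb:
  "\<lbrakk>ys \<noteq> []; set ys \<subseteq> carrier S; u \<in> carrier S; \<And>x. x \<in> set ys \<Longrightarrow> u \<sqinter> x = u\<rbrakk>
    \<Longrightarrow> u \<sqinter> list_meet S ys = u"
proof (induction ys rule: rev_nonempty_induct)
  case (snoc y ys)
  then show ?case
    using meet_assoc[of u "list_meet S ys" y] by (simp add: list_meet_snoc)
qed (simp add: list_meet_def)

lemma meet_list_join_eq_zero_iff:
  "\<lbrakk>ys \<noteq> []; set ys \<subseteq> carrier S; u \<in> carrier S\<rbrakk>
    \<Longrightarrow> u \<sqinter> list_join S ys = \<zero> \<longleftrightarrow> (\<forall>x\<in>set ys. u \<sqinter> x = \<zero>)"
proof (induction ys rule: rev_nonempty_induct)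
  case (snoc y ys)
  define a b where "a = u \<sqinter> list_join S ys" and "b = u \<sqinter> y"
  have ab: "a \<in> carrier S" "b \<in> carrier S"
    using snoc by (simp_all add: a_def b_def)
  have "u \<sqinter> list_join S (ys @ [y]) = a \<squnion> b"
    using snoc by (simp add: list_join_snoc meet_join_distrib a_def b_def)
  also have "\<dots> = \<zero> \<longleftrightarrow> a = \<zero> \<and> b = \<zero>"
    using ab join_eq_zeroD[OF ab] by auto
  also have "a = \<zero> \<longleftrightarrow> (\<forall>x\<in>set ys. u \<sqinter> x = \<zero>)"
    using snoc by (simp add: a_def)
  finally show ?case
    by (auto simp: b_def)
qed (simp add: list_join_def)

end

section \<open>Coordinates of a free algebra\<close>

text \<open>
  The value \<open>None\<close> is the zero; on the other elements meet is the left projection and join the right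
  one, so that they form a single \<open>\<D>\<close>-class.
\<close>
definition flat_left :: "'a option sba" where
  "flat_left =
     \<lparr>carrier = UNIV,
      meet = (\<lambda>a b. if b = None then None else a),
      join = (\<lambda>a b. if b = None then a else b),
      diff = (\<lambda>a b. if b = None then a else None),
      zero = None\<rparr>"

lemma left_handed_sba_flat_left: "left_handed_sba flat_left"
  by unfold_locales (simp_all add: flat_left_def del: not_None_eq)

text \<open>
  Of the universal property of the generators \<open>G\<close> only the maps into a flat algebra are demanded:
  they give all coordinates of the product decomposition. Freeness is kept abstract in this way so
  that the opposite of a free right-handed algebra is covered, too.
\<close>
locale finitely_generated_free_left = left_handed_sba +
  fixes G :: "'a set"
  assumes finite_gens: "finite G"
    and gens_carrier: "G \<subseteq> carrier S"
    and generated [consumes 1, case_names gen zero meet join diff]: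
      "\<lbrakk>x \<in> carrier S; \<And>g. g \<in> G \<Longrightarrow> P g; P \<zero>;
        \<And>x y. \<lbrakk>x \<in> carrier S; y \<in> carrier S; P x; P y\<rbrakk> \<Longrightarrow> P (x \<sqinter> y);
        \<And>x y. \<lbrakk>x \<in> carrier S; y \<in> carrier S; P x; P y\<rbrakk> \<Longrightarrow> P (x \<squnion> y);
        \<And>x y. \<lbrakk>x \<in> carrier S; y \<in> carrier S; P x; P y\<rbrakk> \<Longrightarrow> P (x \<setminus> y)\<rbrakk> \<Longrightarrow> P x"
    and flat_extension: "\<exists>h \<in> sba_hom S (flat_left :: 'a option sba). \<forall>g\<in>G. h g = f g"
begin

text \<open>
  The projection to the coordinate \<open>A\<close> of the product of flat algebras.
  By \<open>val_in\<close>, it takes values in \<open>A\<close> with a zero.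
\<close>
definition val :: "'a set \<Rightarrow> 'a \<Rightarrow> 'a option" where
  "val A = (SOME h. h \<in> sba_hom S flat_left \<and> (\<forall>g\<in>G. h g = (if g \<in> A then Some g else None)))"

lemma val_hom: "val A \<in> sba_hom S flat_left"
  and val_gen: "g \<in> G \<Longrightarrow> val A g = (if g \<in> A then Some g else None)"
proof -
  have "\<exists>h. h \<in> sba_hom S flat_left \<and> (\<forall>g\<in>G. h g = (if g \<in> A then Some g else None))"
    using flat_extension[of "\<lambda>g. if g \<in> A then Some g else None"] by auto
  from someI_ex[OF this, folded val_def]
  show "val A \<in> sba_hom S flat_left"
    "g \<in> G \<Longrightarrow> val A g = (if g \<in> A then Some g else None)" by auto
qed

lemma val_meet [simp]: "\<lbrakk>x \<in> carrier S; y \<in> carrier S\<rbrakk>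
    \<Longrightarrow> val A (x \<sqinter> y) = (if val A y = None then None else val A x)"
  and val_join [simp]: "\<lbrakk>x \<in> carrier S; y \<in> carrier S\<rbrakk>
    \<Longrightarrow> val A (x \<squnion> y) = (if val A y = None then val A x else val A y)"
  and val_diff [simp]: "\<lbrakk>x \<in> carrier S; y \<in> carrier S\<rbrakk>
    \<Longrightarrow> val A (x \<setminus> y) = (if val A y = None then val A x else None)"
  and val_zero [simp]: "val A \<zero> = None"
  using val_hom[of A] by (auto simp: sba_hom_def flat_left_def)

lemma val_in: "x \<in> carrier S \<Longrightarrow> val A x \<in> insert None (Some ` (G \<inter> A))"
proof (induction x rule: generated)
  case (gen g)
  then show ?case by (auto simp: val_gen)
qed auto

lemma val_empty: "x \<in> carrier S \<Longrightarrow> val {} x = None"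
  using val_in[of x "{}"] by simp

section \<open>Cells\<close>

context
  fixes ys k
  assumes ys: "ys \<in> permutations_of_set G" and k: "1 \<le> k" "k \<le> length ys"
begin

lemma take_drop_arrangement:
  "take k ys \<noteq> []" "set (take k ys) \<subseteq> carrier S" "set (drop k ys) \<subseteq> carrier S"
  "set (drop k ys) = G - set (take k ys)" "set (take k ys) \<subseteq> G" "hd (take k ys) = hd ys"
  "hd ys \<in> set (take k ys)"
proof -
  have G: "set ys = G" and d: "distinct ys"
    using ys by (auto simp: permutations_of_set_def)
  show "take k ys \<noteq> []" "hd (take k ys) = hd ys"
    using k by (auto simp: hd_take)
  then show "hd ys \<in> set (take k ys)"
    by (metis hd_in_set)
  show "set (take k ys) \<subseteq> G" "set (take k ys) \<subseteq> carrier S" "set (drop k ys) \<subseteq> carrier S"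
    using G gens_carrier by (auto dest: in_set_takeD in_set_dropD)
  show "set (drop k ys) = G - set (take k ys)"
    using d G set_take_disj_set_drop_if_distinct[OF d, of k k]
    by (metis Diff_cancel Diff_triv Int_commute Un_Diff append_take_drop_id inf_sup_aci(1)
        order_refl set_append sup_bot_left)
qed

lemma atom_term_closed: "atom_term S ys k \<in> carrier S"
proof (cases "k = length ys")
  case False
  then have "drop k ys \<noteq> []" using k by simp
  then show ?thesis
    using take_drop_arrangement by (simp add: atom_term_def)
qed (use take_drop_arrangement in \<open>simp add: atom_term_def\<close>)

lemma atom_term_meet_gen:
  assumes "g \<in> G"
  shows "atom_term S ys k \<sqinter> g = (if g \<in> set (take k ys) then atom_term S ys k else \<zero>)"
proof (cases "k = length ys")
  case True
  then have "g \<in> set ys"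
    using take_drop_arrangement(4) assms by auto
  with True show ?thesis
    using take_drop_arrangement by (simp add: atom_term_def list_meet_meet)
next
  case False
  define p q where "p = list_meet S (take k ys)" and "q = list_join S (drop k ys)"
  have u: "atom_term S ys k = p \<setminus> q" and ne: "drop k ys \<noteq> []"
    using False k by (simp_all add: atom_term_def p_def q_def)
  have [simp]: "p \<in> carrier S" "q \<in> carrier S" "g \<in> carrier S"
    using take_drop_arrangement ne gens_carrier assms by (auto simp: p_def q_def)
  show ?thesis
  proof (cases "g \<in> set (take k ys)")
    case True
    then have "p \<sqinter> g = p"
      using take_drop_arrangement by (simp add: p_def list_meet_meet)
    then have "(p \<setminus> q) \<sqinter> g = p \<setminus> q"
      using meet_assoc[of "p \<setminus> q" p g] by (simp add: diff_meet_self)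
    with True u show ?thesis by simp
  next
    case g: False
    have "(p \<setminus> q) \<sqinter> q = \<zero>"
      by (simp add: diff_meet_subtrahend)
    then have "\<forall>x\<in>set (drop k ys). (p \<setminus> q) \<sqinter> x = \<zero>"
      using ne take_drop_arrangement by (simp add: q_def meet_list_join_eq_zero_iff flip: p_def)
    with g u assms take_drop_arrangement show ?thesis by simp
  qed
qed

lemma hd_meet_atom_term: "hd ys \<sqinter> atom_term S ys k = atom_term S ys k"
proof -
  define p where "p = list_meet S (take k ys)"
  have p: "hd ys \<sqinter> p = p" "p \<in> carrier S" "hd ys \<in> carrier S"
    using hd_meet_list_meet[of "take k ys"] take_drop_arrangement by (auto simp: p_def)
  show ?thesis
  proof (cases "k = length ys")
    case True
    with p show ?thesis by (simp add: atom_term_def p_def)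
  next
    case False
    define q where "q = list_join S (drop k ys)"
    have "q \<in> carrier S"
      using False k take_drop_arrangement by (simp add: q_def)
    with p have "hd ys \<sqinter> (p \<setminus> q) = p \<setminus> q"
      using meet_assoc[of "hd ys" p "p \<setminus> q"] by (simp add: meet_diff_self)
    with False show ?thesis by (simp add: atom_term_def p_def q_def)
  qed
qed

text \<open>
  Conversely to \<open>atom_term_meet_gen\<close>, an element placed like the term with respect to every
  generator is absorbed by it: it lies inside the meet and misses the join.
\<close>
lemma meet_atom_term_absorb:
  assumes u: "u \<in> carrier S"
    and gens: "\<And>g. g \<in> G \<Longrightarrow> u \<sqinter> g = (if g \<in> set (take k ys) then u else \<zero>)"
  shows "u \<sqinter> atom_term S ys k = u"
proof -
  have m: "u \<sqinter> list_meet S (take k ys) = u"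
    using take_drop_arrangement u gens by (intro meet_list_meet_absorb) auto
  show ?thesis
  proof (cases "k = length ys")
    case False
    then have ne: "drop k ys \<noteq> []" using k by simp
    then have "u \<sqinter> list_join S (drop k ys) = \<zero>"
      using take_drop_arrangement u gens by (simp add: meet_list_join_eq_zero_iff)
    with m ne show ?thesis
      using u take_drop_arrangement by (auto simp: atom_term_def intro: meet_diff_absorb)
  qed (use m in \<open>simp add: atom_term_def\<close>)
qed

lemma val_atom_term: "val (set (take k ys)) (atom_term S ys k) \<noteq> None"
proof -
  let ?A = "set (take k ys)"
  have p: "val ?A (list_meet S zs) \<noteq> None" if "zs \<noteq> []" "set zs \<subseteq> ?A" for zs
    using that
  proof (induction zs rule: rev_nonempty_induct)
    case (single x)
    then show ?case using take_drop_arrangement(5) by (auto simp: list_meet_def val_gen)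
  next
    case (snoc x zs)
    then have "set zs \<subseteq> carrier S" "x \<in> carrier S" "x \<in> G"
      using take_drop_arrangement by auto
    with snoc show ?case by (simp add: list_meet_snoc val_gen)
  qed
  have q: "val ?A (list_join S zs) = None" if "zs \<noteq> []" "set zs \<subseteq> G - ?A" for zs
    using that
  proof (induction zs rule: rev_nonempty_induct)
    case (single x)
    then show ?case by (auto simp: list_join_def val_gen)
  next
    case (snoc x zs)
    then have "set zs \<subseteq> carrier S" "x \<in> carrier S"
      using gens_carrier by auto
    with snoc show ?case by (simp add: list_join_snoc val_gen)
  qed
  show ?thesis
  proof (cases "k = length ys")
    case True
    with p[of ys] show ?thesis
      using take_drop_arrangement(1) by (simp add: atom_term_def)
  next
    case False
    with k p[of "take k ys"] q[of "drop k ys"] show ?thesis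
      using take_drop_arrangement by (simp add: atom_term_def)
  qed
qed

end

text \<open>
  By the previous lemmas the two terms absorb each other, so they are \<open>\<D>\<close>-related; and both lie
  below the common first generator.
\<close>
lemma atom_term_eqI:
  assumes ys: "ys \<in> permutations_of_set G" "1 \<le> k" "k \<le> length ys"
    and zs: "zs \<in> permutations_of_set G" "1 \<le> l" "l \<le> length zs"
    and eq: "set (take k ys) = set (take l zs)" "hd ys = hd zs"
  shows "atom_term S ys k = atom_term S zs l"
proof (rule D_related_below_eq)
  show "hd ys \<in> carrier S"
    using take_drop_arrangement[OF ys] by auto
qed (use hd_meet_atom_term[OF ys] hd_meet_atom_term[OF zs] eq
    meet_atom_term_absorb[OF ys] meet_atom_term_absorb[OF zs]
    atom_term_meet_gen[OF ys] atom_term_meet_gen[OF zs]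
    atom_term_closed[OF ys] atom_term_closed[OF zs] in simp_all)

lemma arrangement_exists:
  assumes A: "A \<subseteq> G" and x: "x \<in> A"
  shows "\<exists>ys \<in> permutations_of_set G. set (take (card A) ys) = A \<and> hd ys = x"
proof -
  have fin: "finite A" using A finite_gens finite_subset by blast
  obtain as where as: "set as = A - {x}" "distinct as"
    using finite_distinct_list[of "A - {x}"] fin by auto
  obtain bs where bs: "set bs = G - A" "distinct bs"
    using finite_distinct_list[of "G - A"] finite_gens by auto
  have "length (x # as) = card A"
    using distinct_card[of "x # as"] as x by (simp add: insert_absorb)
  then have "take (card A) ((x # as) @ bs) = x # as"
    by (metis append_eq_conv_conj)
  then show ?thesis
    using as bs A x by (intro bexI[of _ "(x # as) @ bs"]) (auto simp: permutations_of_set_def)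
qed

text \<open>
  The tuple whose only nonzero entry is \<open>x\<close>, at the coordinate \<open>A\<close>. Any arrangement of \<open>G\<close> that
  lists \<open>A\<close> first, beginning with \<open>x\<close>, gives the same element by \<open>atom_term_eqI\<close>.
\<close>
definition cell :: "'a set \<Rightarrow> 'a \<Rightarrow> 'a" where
  "cell A x = atom_term S
     (SOME ys. ys \<in> permutations_of_set G \<and> set (take (card A) ys) = A \<and> hd ys = x) (card A)"

lemma cell_arrangement:
  assumes "A \<subseteq> G" "x \<in> A"
  obtains ys where "ys \<in> permutations_of_set G" "1 \<le> card A" "card A \<le> length ys"
    "set (take (card A) ys) = A" "hd ys = x" "cell A x = atom_term S ys (card A)"
proof -
  let ?P = "\<lambda>ys. ys \<in> permutations_of_set G \<and> set (take (card A) ys) = A \<and> hd ys = x"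
  have "?P (SOME ys. ?P ys)"
    using arrangement_exists[OF assms] by (intro someI_ex[of ?P]) blast
  moreover have "finite A"
    using assms finite_gens finite_subset by blast
  then have "1 \<le> card A"
    using assms by (auto simp: Suc_le_eq card_gt_0_iff)
  moreover have "card A \<le> length ys" if "?P ys" for ys
    using that assms finite_gens by (auto simp: length_finite_permutations_of_set card_mono)
  ultimately show thesis
    by (intro that[of "SOME ys. ?P ys"]) (auto simp: cell_def)
qed

lemma atom_term_eq_cell:
  assumes "ys \<in> permutations_of_set G" "1 \<le> k" "k \<le> length ys"
  shows "atom_term S ys k = cell (set (take k ys)) (hd ys)"
  by (rule cell_arrangement[of "set (take k ys)" "hd ys"])
     (use take_drop_arrangement[OF assms] assms in \<open>auto intro: atom_term_eqI\<close>)

lemma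
  assumes A: "A \<subseteq> G" "x \<in> A"
  shows cell_closed [simp]: "cell A x \<in> carrier S"
    and cell_meet_gen: "g \<in> G \<Longrightarrow> cell A x \<sqinter> g = (if g \<in> A then cell A x else \<zero>)"
    and gen_meet_cell_self: "x \<sqinter> cell A x = cell A x"
    and meet_cell_absorb: "\<lbrakk>u \<in> carrier S; \<And>g. g \<in> G \<Longrightarrow> u \<sqinter> g = (if g \<in> A then u else \<zero>)\<rbrakk>
      \<Longrightarrow> u \<sqinter> cell A x = u"
    and val_cell: "val A (cell A x) = Some x"
proof -
  obtain ys where ys: "ys \<in> permutations_of_set G" "1 \<le> card A" "card A \<le> length ys"
    and eq: "set (take (card A) ys) = A" "hd ys = x" "cell A x = atom_term S ys (card A)"
    using cell_arrangement[OF A] by blast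
  note [simp] = atom_term_closed[OF ys]
  show "cell A x \<in> carrier S"
    "g \<in> G \<Longrightarrow> cell A x \<sqinter> g = (if g \<in> A then cell A x else \<zero>)"
    "\<lbrakk>u \<in> carrier S; \<And>g. g \<in> G \<Longrightarrow> u \<sqinter> g = (if g \<in> A then u else \<zero>)\<rbrakk>
      \<Longrightarrow> u \<sqinter> cell A x = u"
    using atom_term_meet_gen[OF ys] meet_atom_term_absorb[OF ys] by (simp_all add: eq)
  show xc: "x \<sqinter> cell A x = cell A x"
    using hd_meet_atom_term[OF ys] by (simp add: eq)
  have "x \<in> carrier S"
    using A gens_carrier by auto
  moreover have "val A (cell A x) \<noteq> None"
    using val_atom_term[OF ys] by (simp add: eq)
  ultimately have "val A (x \<sqinter> cell A x) = Some x"
    using A by (auto simp: val_gen eq)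
  then show "val A (cell A x) = Some x"
    by (simp add: xc)
qed

lemma cell_meet_cell:
  assumes "A \<subseteq> G" "x \<in> A" "y \<in> A"
  shows "cell A x \<sqinter> cell A y = cell A x"
  using assms by (intro meet_cell_absorb) (auto simp: cell_meet_gen)

text \<open>
  For \<open>g \<in> A\<close>, both sides lie below \<open>g\<close> and are \<open>\<D>\<close>-related.
\<close>
lemma gen_meet_cell:
  assumes A: "A \<subseteq> G" "x \<in> A" and g: "g \<in> G"
  shows "g \<sqinter> cell A x = (if g \<in> A then cell A g else \<zero>)"
proof (cases "g \<in> A")
  case True
  have [simp]: "g \<in> carrier S" using g gens_carrier by auto
  have "g \<sqinter> cell A x = cell A g"
  proof (rule D_related_below_eq)
    show "g \<sqinter> (g \<sqinter> cell A x) = g \<sqinter> cell A x"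
      using A meet_assoc[of g g "cell A x"] by simp
    show "g \<sqinter> cell A x \<sqinter> cell A g = g \<sqinter> cell A x"
      using A True by (simp add: meet_assoc cell_meet_cell)
    have "cell A g \<sqinter> g = cell A g"
      using A True g by (simp add: cell_meet_gen)
    then show "cell A g \<sqinter> (g \<sqinter> cell A x) = cell A g"
      using A True cell_meet_cell meet_assoc[of "cell A g" g "cell A x"] by simp
  qed (use A True in \<open>simp_all add: gen_meet_cell_self\<close>)
  with True show ?thesis by simp
next
  case False
  then show ?thesis
    using A g gens_carrier meet_eq_zero_commute[of "cell A x" g] by (auto simp: cell_meet_gen)
qed

text \<open>
  Meeting with a cell at \<open>A\<close> isolates the coordinate \<open>A\<close>. The result does not depend on \<open>x\<close>, which
  lets the induction pass through meets, and cells at the same \<open>A\<close> behave like the flat algebra.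
\<close>
lemma meet_cell:
  assumes "t \<in> carrier S" and A: "A \<subseteq> G" "x \<in> A"
  shows "t \<sqinter> cell A x = (case val A t of None \<Rightarrow> \<zero> | Some y \<Rightarrow> cell A y)"
  using assms(1) A(2)
proof (induction t arbitrary: x rule: generated)
  case (gen g)
  then show ?case using A by (simp add: gen_meet_cell val_gen)
next
  case (meet s t)
  have "val A t \<in> insert None (Some ` (G \<inter> A))"
    using meet by (intro val_in)
  with meet A show ?case
    by (auto simp: meet_assoc split: option.splits)
next
  case (join s t)
  have v: "val A s \<in> insert None (Some ` (G \<inter> A))" "val A t \<in> insert None (Some ` (G \<inter> A))"
    using join by (intro val_in; simp)+
  have "cell A y \<squnion> cell A z = cell A z" if "y \<in> A" "z \<in> A" for y z
    using that A meet_join_absorb'[of "cell A z" "cell A y"] by (simp add: cell_meet_cell)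
  with join v A show ?case
    by (auto simp: join_meet_distrib split: option.splits)
next
  case (diff s t)
  have v: "val A s \<in> insert None (Some ` (G \<inter> A))" "val A t \<in> insert None (Some ` (G \<inter> A))"
    using diff by (intro val_in; simp)+
  note [simp] = diff.hyps
  show ?case
  proof (cases "val A t")
    case None
    then have t: "t \<sqinter> cell A x = \<zero>"
      using diff by simp
    have "s \<sqinter> cell A x = ((s \<sqinter> t) \<squnion> (s \<setminus> t)) \<sqinter> cell A x"
      by (simp add: join_meet_diff)
    also have "\<dots> = (s \<setminus> t) \<sqinter> cell A x"
      using diff.prems A t by (simp add: join_meet_distrib meet_assoc)
    finally show ?thesis
      using None diff by simp
  next
    case (Some y)
    with v have y: "y \<in> A" by auto
    have "(s \<setminus> t) \<sqinter> cell A y = (s \<setminus> t) \<sqinter> t \<sqinter> cell A x"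
      using Some diff A by (simp add: meet_assoc)
    also have "\<dots> = \<zero>"
      using diff.prems A by (simp add: diff_meet_subtrahend)
    finally have "(s \<setminus> t) \<sqinter> cell A x = \<zero>"
      using diff.prems A y cell_meet_cell
      by (intro meet_eq_zero_trans[of "s \<setminus> t" "cell A y" "cell A x"]) auto
    with Some show ?thesis by simp
  qed
qed (use A in auto)

section \<open>The coordinates separate points\<close>

text \<open>
  The set \<open>U\<close> collects the generators \<open>z\<close> along which \<open>u\<close> has not been cut yet. Each step replaces
  \<open>u\<close> by its parts \<open>u \<sqinter> z\<close> and \<open>u \<setminus> z\<close>, whose coordinates vanish as well. When \<open>U\<close> is exhausted, \<open>u\<close> lies
  inside a cell, which it also avoids. The generator \<open>x\<close> above \<open>u\<close> ensures that the set \<open>A\<close>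
  belonging to this cell is nonempty.
\<close>
lemma eq_zero_if_val_None:
  assumes "finite U" "U \<subseteq> G" "u \<in> carrier S" "\<And>A. A \<subseteq> G \<Longrightarrow> val A u = None"
    and "x \<in> G" "u \<sqinter> x = u" "\<And>y. y \<in> G - U \<Longrightarrow> u \<sqinter> y = u \<or> u \<sqinter> y = \<zero>"
  shows "u = \<zero>"
  using assms
proof (induction U arbitrary: u rule: finite_induct)
  case empty
  define A where "A = {y \<in> G. u \<sqinter> y = u}"
  have A: "A \<subseteq> G" "x \<in> A"
    using empty by (auto simp: A_def)
  have "u = u \<sqinter> cell A x"
    using A empty by (intro meet_cell_absorb[symmetric]) (auto simp: A_def)
  also have "\<dots> = \<zero>"
    using A empty by (simp add: meet_cell)
  finally show ?case .
next
  case (insert z U)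
  note [simp] = \<open>u \<in> carrier S\<close>
  have [simp]: "x \<in> carrier S" "z \<in> carrier S"
    using insert.prems gens_carrier by auto
  have "u \<sqinter> z = \<zero>"
  proof (rule insert.IH)
    \<comment> \<open>Decisions made before survive: with \<open>u = u \<sqinter> y\<close>, left regularity moves \<open>y\<close> past \<open>z\<close>.\<close>
    have *: "(u \<sqinter> z) \<sqinter> y = u \<sqinter> z" if "y \<in> carrier S" "u \<sqinter> y = u" for y
    proof -
      have "(u \<sqinter> z) \<sqinter> y = (u \<sqinter> y) \<sqinter> (z \<sqinter> y)"
        using that by (simp add: meet_assoc)
      also have "\<dots> = u \<sqinter> (y \<sqinter> (z \<sqinter> y))"
        using that(1) by (simp add: meet_assoc)
      also have "\<dots> = (u \<sqinter> y) \<sqinter> z"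
        using that(1) by (simp add: meet_assoc left_regular)
      finally show ?thesis using that by simp
    qed
    then show "(u \<sqinter> z) \<sqinter> x = u \<sqinter> z"
      using insert.prems by simp
    fix y assume y: "y \<in> G - U"
    then have [simp]: "y \<in> carrier S" using gens_carrier by auto
    consider "y = z" | "u \<sqinter> y = u" | "u \<sqinter> y = \<zero>"
      using insert.prems(6)[of y] y by auto
    then show "(u \<sqinter> z) \<sqinter> y = u \<sqinter> z \<or> (u \<sqinter> z) \<sqinter> y = \<zero>"
    proof cases
      case 3
      have "(u \<sqinter> z) \<sqinter> y = u \<sqinter> (z \<sqinter> (u \<sqinter> y))"
        using left_meet[of u z] meet_assoc[of "u \<sqinter> z" u y] meet_assoc[of u z "u \<sqinter> y"] by simp
      with 3 show ?thesis by simp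
    qed (use * in \<open>simp_all add: meet_assoc\<close>)
  qed (use insert.prems in auto)
  moreover have "u \<setminus> z = \<zero>"
  proof (rule insert.IH)
    have *: "(u \<setminus> z) \<sqinter> y = (u \<setminus> z) \<sqinter> (u \<sqinter> y)" if "y \<in> carrier S" for y
      using that meet_assoc[of "u \<setminus> z" u y] by (simp add: diff_meet_self)
    show "(u \<setminus> z) \<sqinter> x = u \<setminus> z"
      using insert.prems *[of x] by (simp add: diff_meet_self)
    fix y assume y: "y \<in> G - U"
    then have [simp]: "y \<in> carrier S" using gens_carrier by auto
    show "(u \<setminus> z) \<sqinter> y = u \<setminus> z \<or> (u \<setminus> z) \<sqinter> y = \<zero>"
    proof (cases "y = z")
      case False
      then show ?thesis
        using insert.prems(6)[of y] y *[of y] by (auto simp: diff_meet_self)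
    qed (simp add: diff_meet_subtrahend)
  qed (use insert.prems in auto)
  ultimately show ?case
    using join_meet_diff[of u z] by simp
qed

text \<open>
  The element \<open>e\<close> is a join of cells, one at each coordinate in \<open>\<A>\<close>; by \<open>meet_cell\<close> the meet
  \<open>s \<sqinter> e\<close> is then a join of cells read off from the coordinates of \<open>s\<close>.
\<close>
lemma separator_exists:
  assumes "finite \<A>" "\<A> \<subseteq> Pow G - {{}}"
  shows "\<exists>e \<in> carrier S. (\<forall>A\<in>\<A>. val A e \<noteq> None) \<and>
    (\<forall>s\<in>carrier S. \<forall>t\<in>carrier S. (\<forall>A\<in>\<A>. val A s = val A t) \<longrightarrow> s \<sqinter> e = t \<sqinter> e)"
  using assms
proof (induction \<A> rule: finite_induct)
  case empty
  show ?case by (intro bexI[of _ \<zero>]) auto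
next
  case (insert A \<A>)
  then have "\<exists>e \<in> carrier S. (\<forall>A\<in>\<A>. val A e \<noteq> None) \<and>
    (\<forall>s\<in>carrier S. \<forall>t\<in>carrier S. (\<forall>A\<in>\<A>. val A s = val A t) \<longrightarrow> s \<sqinter> e = t \<sqinter> e)"
    by auto
  then obtain e where e: "e \<in> carrier S" "\<And>B. B \<in> \<A> \<Longrightarrow> val B e \<noteq> None"
    "\<And>s t. \<lbrakk>s \<in> carrier S; t \<in> carrier S; \<forall>A\<in>\<A>. val A s = val A t\<rbrakk> \<Longrightarrow> s \<sqinter> e = t \<sqinter> e"
    by (elim bexE conjE) blast
  obtain x where x: "A \<subseteq> G" "x \<in> A"
    using insert.prems by auto
  have "val B (e \<squnion> cell A x) \<noteq> None" if "B \<in> insert A \<A>" for B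
    using that e(1) e(2)[of B] x val_cell[OF x] by (cases "B = A") auto
  moreover have "s \<sqinter> (e \<squnion> cell A x) = t \<sqinter> (e \<squnion> cell A x)"
    if st: "s \<in> carrier S" "t \<in> carrier S" "\<forall>B\<in>insert A \<A>. val B s = val B t" for s t
  proof -
    have "s \<sqinter> e = t \<sqinter> e"
      using st by (intro e(3)) auto
    moreover have "s \<sqinter> cell A x = t \<sqinter> cell A x"
      using st x by (simp add: meet_cell)
    ultimately show ?thesis
      using st e(1) x by (simp add: meet_join_distrib)
  qed
  ultimately show ?case
    using join_closed[OF e(1) cell_closed[OF x]] by blast
qed

text \<open>
  With \<open>e\<close> a separator for all nonempty \<open>A\<close>, the claim reduces to \<open>r \<sqinter> e = r\<close>. This property passes
  from the generators to all elements; for a generator \<open>g\<close>, the rest \<open>g \<setminus> e\<close> has all coordinates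
  zero and therefore vanishes.
\<close>
theorem val_separates:
  assumes st: "s \<in> carrier S" "t \<in> carrier S" and eq: "\<And>A. A \<subseteq> G \<Longrightarrow> val A s = val A t"
  shows "s = t"
proof -
  have "finite (Pow G - {{}})"
    using finite_gens by simp
  from separator_exists[OF this subset_refl] obtain e where e: "e \<in> carrier S" "\<forall>A\<in>Pow G - {{}}. val A e \<noteq> None"
    and e_sep: "\<forall>s\<in>carrier S. \<forall>t\<in>carrier S.
      (\<forall>A\<in>Pow G - {{}}. val A s = val A t) \<longrightarrow> s \<sqinter> e = t \<sqinter> e"
    by (elim bexE conjE)
  note [simp] = e(1)
  have absorb: "r \<sqinter> e = r" if "r \<in> carrier S" for r
    using that
  proof (induction r rule: generated)
    case (gen g)
    then have [simp]: "g \<in> carrier S" using gens_carrier by auto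
    have "g \<setminus> e = \<zero>"
    proof (rule eq_zero_if_val_None[OF finite_gens subset_refl])
      show "val A (g \<setminus> e) = None" if "A \<subseteq> G" for A
      proof (cases "A = {}")
        case False
        with that e(2) have "val A e \<noteq> None" by blast
        then show ?thesis by auto
      qed (simp add: val_empty)
    qed (use gen in \<open>auto simp: diff_meet_self\<close>)
    then show ?case
      using join_meet_diff[of g e] by simp
  next
    case (diff x y)
    then have "(x \<setminus> y) \<sqinter> e = (x \<setminus> y) \<sqinter> (x \<sqinter> e)"
      using meet_assoc[of "x \<setminus> y" x e] by (simp add: diff_meet_self)
    with diff show ?case by (simp add: diff_meet_self)
  qed (simp_all add: meet_assoc join_meet_distrib)
  have "s \<sqinter> e = t \<sqinter> e"
    using e_sep eq st by blast
  then show ?thesis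
    by (simp add: absorb st)
qed

lemma finite_carrier: "finite (carrier S)"
proof (rule finite_imageD)
  let ?f = "\<lambda>t. restrict (\<lambda>A. val A t) (Pow G)"
  have "?f ` carrier S \<subseteq> PiE (Pow G) (\<lambda>_. insert None (Some ` G))"
  proof (rule image_subsetI)
    fix t assume t: "t \<in> carrier S"
    have "val A t \<in> insert None (Some ` G)" for A
      using val_in[OF t, of A] by auto
    then show "?f t \<in> PiE (Pow G) (\<lambda>_. insert None (Some ` G))"
      unfolding restrict_PiE_iff by blast
  qed
  then show "finite (?f ` carrier S)"
    by (rule finite_subset) (use finite_gens in \<open>simp add: finite_PiE\<close>)
  show "inj_on ?f (carrier S)"
  proof (intro inj_onI val_separates)
    fix s t A assume "?f s = ?f t" "A \<subseteq> G"
    then show "val A s = val A t"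
      by (metis PowI restrict_apply')
  qed
qed

section \<open>Atoms and atomic \<open>\<D>\<close>-classes\<close>

lemma cell_nonzero: "A \<subseteq> G \<Longrightarrow> x \<in> A \<Longrightarrow> cell A x \<noteq> \<zero>"
  by (metis val_cell val_zero option.distinct(1))

text \<open>
  A generator in exactly one of \<open>A\<close> and \<open>B\<close> tells the two coordinates apart.
\<close>
lemma val_cell_other:
  assumes "A \<subseteq> G" "x \<in> A" "B \<subseteq> G" "A \<noteq> B"
  shows "val B (cell A x) = None"
proof -
  obtain g where g: "g \<in> G" "g \<in> A \<longleftrightarrow> g \<notin> B"
    using assms by blast
  then have car: "g \<in> carrier S" "cell A x \<in> carrier S"
    using gens_carrier assms by auto
  show ?thesis
  proof (cases "g \<in> A")
    case True
    then have "val B (cell A x) = val B (cell A x \<sqinter> g)"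
      using g assms by (simp add: cell_meet_gen)
    also have "\<dots> = None"
      using True g car by (simp add: val_gen)
    finally show ?thesis .
  next
    case False
    then have "None = val B (cell A x \<sqinter> g)"
      using g assms by (simp add: cell_meet_gen)
    also have "\<dots> = val B (cell A x)"
      using False g car by (simp add: val_gen)
    finally show ?thesis by simp
  qed
qed

lemma nonzero_val:
  assumes "b \<in> carrier S" "b \<noteq> \<zero>"
  obtains A x where "A \<subseteq> G" "x \<in> A" "val A b = Some x"
proof -
  have "\<exists>A\<subseteq>G. val A b \<noteq> None"
  proof (rule ccontr)
    assume "\<not> (\<exists>A\<subseteq>G. val A b \<noteq> None)"
    then have "b = \<zero>"
      using assms(1) by (intro val_separates) auto
    with assms(2) show False ..
  qed
  then obtain A where A: "A \<subseteq> G" "val A b \<noteq> None" by blast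
  then obtain x where "val A b = Some x" by auto
  moreover have "x \<in> A"
    using calculation val_in[OF assms(1), of A] by auto
  ultimately show thesis
    using that A by blast
qed

text \<open>
  A nonzero element has a nonzero coordinate, hence a cell below it; and the meet of any element with
  a cell at \<open>A\<close> is zero or again a cell at \<open>A\<close>.
\<close>
theorem atoms_eq_cells: "sba_atoms S = {cell A x | A x. A \<subseteq> G \<and> x \<in> A}"
proof (intro equalityI subsetI)
  fix b assume b: "b \<in> sba_atoms S"
  then have car: "b \<in> carrier S" and "b \<noteq> \<zero>" by (auto simp: sba_atoms_def)
  then obtain A x where A: "A \<subseteq> G" "x \<in> A" "val A b = Some x"
    by (rule nonzero_val)
  then have "natural_le S (cell A x) b"
    using car by (intro natural_leI) (simp_all add: meet_cell)
  then have "b = cell A x"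
    using b A cell_nonzero[of A x] by (auto simp: sba_atoms_def)
  then show "b \<in> {cell A x | A x. A \<subseteq> G \<and> x \<in> A}"
    using A by blast
next
  fix a assume "a \<in> {cell A x | A x. A \<subseteq> G \<and> x \<in> A}"
  then obtain A x where A: "A \<subseteq> G" "x \<in> A" and a: "a = cell A x" by auto
  have "b = cell A x" if b: "b \<in> carrier S" "b \<noteq> \<zero>" "natural_le S b (cell A x)" for b
  proof -
    have le: "b \<sqinter> cell A x = b" "cell A x \<sqinter> b = b"
      using b(3) by (auto simp: natural_le_def)
    then obtain y where y: "val A b = Some y" "b = cell A y"
      using meet_cell[OF b(1) A] b(2) by (cases "val A b") auto
    moreover have "y \<in> A"
      using y(1) val_in[OF b(1), of A] by auto
    ultimately show ?thesis
      using le(2) A cell_meet_cell by simp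
  qed
  then show "a \<in> sba_atoms S"
    using A cell_nonzero by (auto simp: sba_atoms_def a)
qed

text \<open>
  Being related by \<open>\<D>\<close> means having the same support, so that the congruence property is inherited
  from the Boolean algebra of sets of coordinates.
\<close>
lemma D_rel_iff_val:
  "(s, t) \<in> D_rel S \<longleftrightarrow> s \<in> carrier S \<and> t \<in> carrier S \<and>
     (\<forall>A\<subseteq>G. val A s = None \<longleftrightarrow> val A t = None)"
proof -
  have "s \<sqinter> t = s \<longleftrightarrow> (\<forall>A\<subseteq>G. val A t = None \<longrightarrow> val A s = None)"
    if st: "s \<in> carrier S" "t \<in> carrier S" for s t
  proof
    assume "s \<sqinter> t = s"
    then show "\<forall>A\<subseteq>G. val A t = None \<longrightarrow> val A s = None"
      using st val_meet by metis
  next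
    assume "\<forall>A\<subseteq>G. val A t = None \<longrightarrow> val A s = None"
    with st show "s \<sqinter> t = s"
      by (intro val_separates) auto
  qed
  then show ?thesis
    by (auto simp: D_rel_iff)
qed

lemma D_rel_congruence: "sba_congruence S (D_rel S)"
  by (auto simp: sba_congruence_def equiv_def refl_on_def sym_def trans_def D_rel_iff_val)

lemma D_rel_cells:
  assumes "A \<subseteq> G" "x \<in> A" "B \<subseteq> G" "y \<in> B"
  shows "(cell A x, cell B y) \<in> D_rel S \<longleftrightarrow> A = B"
proof
  assume "(cell A x, cell B y) \<in> D_rel S"
  then have "val B (cell A x) \<noteq> None"
    using assms by (auto simp: D_rel_iff_val val_cell)
  then show "A = B"
    using val_cell_other[OF assms(1-3)] by metis
next
  assume "A = B"
  then show "(cell A x, cell B y) \<in> D_rel S"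
    using assms cell_meet_cell by (simp add: D_rel_iff)
qed

lemma atomic_D_class_cell:
  assumes A: "A \<subseteq> G" "x \<in> A"
  shows "D_rel S `` {cell A x} \<in> atomic_D_classes S"
proof -
  note eq = sba_congruenceD(1)[OF D_rel_congruence]
  have car: "carrier (sba_quotient S (D_rel S)) = carrier S // D_rel S"
    and zero: "zero (sba_quotient S (D_rel S)) = D_rel S `` {\<zero>}"
    by (simp_all add: sba_quotient_def)
  have nz: "D_rel S `` {cell A x} \<noteq> D_rel S `` {\<zero>}"
  proof
    assume "D_rel S `` {cell A x} = D_rel S `` {\<zero>}"
    then have "(cell A x, \<zero>) \<in> D_rel S"
      using eq_equiv_class[OF _ eq] by simp
    then show False
      using A cell_nonzero[OF A] by (simp add: D_rel_iff)
  qed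
  moreover have "B = D_rel S `` {cell A x}"
    if B: "B \<in> carrier S // D_rel S" "B \<noteq> D_rel S `` {\<zero>}"
      "natural_le (sba_quotient S (D_rel S)) B (D_rel S `` {cell A x})" for B
  proof -
    obtain b where b: "b \<in> carrier S" "B = D_rel S `` {b}"
      using B(1) by (auto elim: quotientE)
    have "B = D_rel S `` {b \<sqinter> cell A x}"
      using B(3) b A by (simp add: natural_le_def sba_quotient_ops[OF D_rel_congruence])
    moreover have "b \<sqinter> cell A x \<noteq> \<zero>"
      using B(2) calculation by auto
    then obtain y where y: "val A b = Some y" "b \<sqinter> cell A x = cell A y"
      using meet_cell[OF b(1) A] by (cases "val A b") auto
    moreover have "y \<in> A"
      using y(1) val_in[OF b(1), of A] by auto
    ultimately show ?thesis
      using A D_rel_cells equiv_class_eq[OF eq] by simp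
  qed
  ultimately show ?thesis
    using A by (auto simp: atomic_D_classes_def sba_atoms_def car zero quotientI)
qed

theorem same_atomic_D_class_cells:
  assumes "A \<subseteq> G" "x \<in> A" "B \<subseteq> G" "y \<in> B"
  shows "(\<exists>C \<in> atomic_D_classes S. cell A x \<in> C \<and> cell B y \<in> C) \<longleftrightarrow> A = B"
proof
  assume "\<exists>C \<in> atomic_D_classes S. cell A x \<in> C \<and> cell B y \<in> C"
  then obtain C where "C \<in> carrier S // D_rel S" "cell A x \<in> C" "cell B y \<in> C"
    by (auto simp: atomic_D_classes_def sba_atoms_def sba_quotient_def)
  then have "(cell A x, cell B y) \<in> D_rel S"
    using sba_congruenceD(1)[OF D_rel_congruence]
    by (meson in_quotient_imp_in_rel insert_subset bot_least)
  then show "A = B"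
    using D_rel_cells assms by simp
next
  assume "A = B"
  then have "(cell A x, cell B y) \<in> D_rel S" "(cell A x, cell A x) \<in> D_rel S"
    using D_rel_cells assms by simp_all
  then show "\<exists>C \<in> atomic_D_classes S. cell A x \<in> C \<and> cell B y \<in> C"
    using atomic_D_class_cell[of A x] assms by (intro bexI[of _ "D_rel S `` {cell A x}"]) auto
qed


lemma atoms_eq_atom_terms:
  "sba_atoms S = {atom_term S ys k | ys k. ys \<in> permutations_of_set G \<and> k \<in> {1..card G}}"
  unfolding atoms_eq_cells
proof (intro equalityI subsetI; elim CollectE exE conjE)
  fix a A x assume A: "A \<subseteq> G" "x \<in> A" and a: "a = cell A x"
  obtain ys where ys: "ys \<in> permutations_of_set G" "1 \<le> card A"
      "cell A x = atom_term S ys (card A)"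
    using cell_arrangement[OF A] by blast
  moreover have "card A \<le> card G"
    using A finite_gens by (intro card_mono)
  ultimately show "a \<in> {atom_term S ys k | ys k. ys \<in> permutations_of_set G \<and> k \<in> {1..card G}}"
    unfolding a by (intro CollectI exI[of _ ys] exI[of _ "card A"]) simp
next
  fix a ys k assume a: "a = atom_term S ys k" and ys: "ys \<in> permutations_of_set G" "k \<in> {1..card G}"
  then have k: "1 \<le> k" "k \<le> length ys"
    by (auto simp: length_finite_permutations_of_set)
  show "a \<in> {cell A x | A x. A \<subseteq> G \<and> x \<in> A}"
    using take_drop_arrangement[OF ys(1) k]
    by (intro CollectI exI[of _ "set (take k ys)"] exI[of _ "hd ys"])
       (simp add: a atom_term_eq_cell[OF ys(1) k])
qed

lemma same_atomic_D_class_atom_terms: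
  assumes ys: "ys \<in> permutations_of_set G" "k \<in> {1..card G}"
    and zs: "zs \<in> permutations_of_set G" "l \<in> {1..card G}"
  shows "(\<exists>C \<in> atomic_D_classes S. atom_term S ys k \<in> C \<and> atom_term S zs l \<in> C) \<longleftrightarrow>
    set (take k ys) = set (take l zs)"
proof -
  have k: "1 \<le> k" "k \<le> length ys" and l: "1 \<le> l" "l \<le> length zs"
    using ys zs by (auto simp: length_finite_permutations_of_set)
  show ?thesis
    using take_drop_arrangement[OF ys(1) k] take_drop_arrangement[OF zs(1) l]
    by (simp add: atom_term_eq_cell[OF ys(1) k] atom_term_eq_cell[OF zs(1) l]
        same_atomic_D_class_cells)
qed

end

section \<open>Arrangements with equal first blocks\<close>

lemma set_take_eq_iff_permutation:
  assumes "ys \<in> permutations_of_set G" "zs \<in> permutations_of_set G"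
    and "k \<le> length ys" "l \<le> length zs"
  shows "set (take k ys) = set (take l zs) \<longleftrightarrow>
    k = l \<and> take k zs \<in> permutations_of_set (set (take k ys))"
proof -
  have d: "distinct ys" "distinct zs"
    using assms by (auto simp: permutations_of_set_def)
  have "card (set (take k ys)) = k" "card (set (take l zs)) = l"
    using d assms by (simp_all add: distinct_card)
  then show ?thesis
    using d by (simp add: permutations_of_set_def) metis
qed

lemma drop_permutation_of_take_permutation:
  assumes ys: "ys \<in> permutations_of_set G" and zs: "zs \<in> permutations_of_set G"
    and take: "take k zs \<in> permutations_of_set (set (take k ys))"
  shows "drop k zs \<in> permutations_of_set (set (drop k ys))"
proof -
  have drop: "set (drop k xs) = G - set (take k xs)" if "xs \<in> permutations_of_set G" for xs
  proof -
    have "distinct (take k xs @ drop k xs)" "set (take k xs @ drop k xs) = G"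
      using that by (simp_all only: append_take_drop_id permutations_of_set_def mem_Collect_eq)
    then show ?thesis
      unfolding distinct_append set_append by blast
  qed
  have "set (take k zs) = set (take k ys)" "distinct zs"
    using take zs by (auto simp: permutations_of_set_def)
  then show ?thesis
    by (simp add: permutations_of_set_def drop[OF ys] drop[OF zs])
qed

section \<open>Left-right duality\<close>

definition opposite :: "'a sba \<Rightarrow> 'a sba" where
  "opposite S = \<lparr>carrier = carrier S, meet = (\<lambda>x y. meet S y x), join = (\<lambda>x y. join S y x),
     diff = diff S, zero = zero S\<rparr>"

lemma opposite_simps [simp]:
  "carrier (opposite S) = carrier S" "meet (opposite S) x y = meet S y x"
  "join (opposite S) x y = join S y x" "diff (opposite S) x y = diff S x y"
  "zero (opposite S) = zero S"
  by (simp_all add: opposite_def)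

lemma sba_hom_opposite: "h \<in> sba_hom (opposite S) T \<longleftrightarrow> h \<in> sba_hom S (opposite T)"
  unfolding sba_hom_def by auto

lemma sba_atoms_opposite: "sba_atoms (opposite S) = sba_atoms S"
  by (auto simp: sba_atoms_def natural_le_def)

lemma sba_quotient_opposite: "sba_quotient (opposite S) \<theta> = opposite (sba_quotient S \<theta>)"
  unfolding sba_quotient_def opposite_def by (auto simp: fun_eq_iff)

context skew_boolean_algebra
begin

lemma atomic_D_classes_opposite: "atomic_D_classes (opposite S) = atomic_D_classes S"
proof -
  have "D_rel (opposite S) = D_rel S"
    by (auto simp: D_rel_def meet_assoc)
  then show ?thesis
    by (simp add: atomic_D_classes_def sba_quotient_opposite sba_atoms_opposite)
qed

lemma list_meet_Cons:
  "\<lbrakk>ys \<noteq> []; set ys \<subseteq> carrier S; y \<in> carrier S\<rbrakk>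
    \<Longrightarrow> list_meet S (y # ys) = y \<sqinter> list_meet S ys"
proof (induction ys rule: rev_nonempty_induct)
  case (snoc x xs)
  then have "list_meet S ((y # xs) @ [x]) = y \<sqinter> list_meet S (xs @ [x])"
    unfolding list_meet_snoc[OF list.distinct(2)] list_meet_snoc[OF snoc.hyps(1)]
    by (simp add: meet_assoc)
  then show ?case by simp
qed (simp add: list_meet_def)

lemma list_join_Cons:
  "\<lbrakk>ys \<noteq> []; set ys \<subseteq> carrier S; y \<in> carrier S\<rbrakk>
    \<Longrightarrow> list_join S (y # ys) = y \<squnion> list_join S ys"
proof (induction ys rule: rev_nonempty_induct)
  case (snoc x xs)
  then have "list_join S ((y # xs) @ [x]) = y \<squnion> list_join S (xs @ [x])"
    unfolding list_join_snoc[OF list.distinct(2)] list_join_snoc[OF snoc.hyps(1)]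
    by (simp add: join_assoc)
  then show ?case by simp
qed (simp add: list_join_def)

lemma list_meet_opposite:
  "\<lbrakk>ys \<noteq> []; set ys \<subseteq> carrier S\<rbrakk> \<Longrightarrow> list_meet (opposite S) ys = list_meet S (rev ys)"
proof (induction ys rule: rev_nonempty_induct)
  case (snoc y ys)
  have "list_meet (opposite S) (ys @ [y]) = y \<sqinter> list_meet (opposite S) ys"
    using snoc.hyps by (simp add: list_meet_def)
  with snoc show ?case
    by (simp add: list_meet_Cons)
qed (simp add: list_meet_def)

lemma list_join_opposite:
  "\<lbrakk>ys \<noteq> []; set ys \<subseteq> carrier S\<rbrakk> \<Longrightarrow> list_join (opposite S) ys = list_join S (rev ys)"
proof (induction ys rule: rev_nonempty_induct)
  case (snoc y ys)
  have "list_join (opposite S) (ys @ [y]) = y \<squnion> list_join (opposite S) ys"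
    using snoc.hyps by (simp add: list_join_def)
  with snoc show ?case
    by (simp add: list_join_Cons)
qed (simp add: list_join_def)

end

text \<open>
  In the opposite algebra, the term of an arrangement has both its blocks, before and after position
  \<open>k\<close>, reversed.
\<close>
definition rev_blocks :: "nat \<Rightarrow> 'a list \<Rightarrow> 'a list" where
  "rev_blocks k ys = rev (take k ys) @ rev (drop k ys)"

lemma rev_blocks_simps:
  assumes "k \<le> length ys"
  shows "take k (rev_blocks k ys) = rev (take k ys)" "drop k (rev_blocks k ys) = rev (drop k ys)"
    "length (rev_blocks k ys) = length ys"
  using assms by (simp_all add: rev_blocks_def)

lemma rev_blocks_rev_blocks: "k \<le> length ys \<Longrightarrow> rev_blocks k (rev_blocks k ys) = ys"
  using rev_blocks_simps[of k ys] by (simp add: rev_blocks_def[of k "rev_blocks k ys"])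

lemma rev_blocks_permutation:
  assumes "ys \<in> permutations_of_set G"
  shows "rev_blocks k ys \<in> permutations_of_set G"
proof -
  have "mset (rev_blocks k ys) = mset (take k ys @ drop k ys)"
    unfolding rev_blocks_def mset_append mset_rev ..
  then have "mset (rev_blocks k ys) = mset ys" by simp
  then show ?thesis
    using assms mset_eq_imp_distinct_iff mset_eq_setD
    unfolding permutations_of_set_def by blast
qed

lemma hd_rev_blocks:
  assumes "1 \<le> k" "k \<le> length ys"
  shows "hd (rev_blocks k ys) = ys ! (k - 1)"
proof -
  have "take k ys \<noteq> []" using assms by auto
  then show ?thesis
    using assms by (simp add: rev_blocks_def hd_rev last_conv_nth)
qed

lemma (in skew_boolean_algebra) atom_term_opposite:
  assumes "set ys \<subseteq> carrier S" "1 \<le> k" "k \<le> length ys"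
  shows "atom_term (opposite S) (rev_blocks k ys) k = atom_term S ys k"
proof -
  have "take k ys \<noteq> []" "set (take k ys) \<subseteq> carrier S" "set (drop k ys) \<subseteq> carrier S"
    using assms by (auto dest: in_set_takeD in_set_dropD)
  moreover have "rev_blocks k ys = rev ys" if "k = length ys"
    using that by (simp add: rev_blocks_def)
  ultimately show ?thesis
    using assms
    by (auto simp: atom_term_def rev_blocks_simps list_meet_opposite list_join_opposite)
qed

lemma left_handed_sba_opposite:
  assumes "right_handed_sba S"
  shows "left_handed_sba (opposite S)"
proof -
  interpret right_handed_sba S by fact
  have a: "x \<sqinter>\<^bsub>S\<^esub> (y \<sqinter>\<^bsub>S\<^esub> x) = y \<sqinter>\<^bsub>S\<^esub> x" "x \<squnion>\<^bsub>S\<^esub> (y \<squnion>\<^bsub>S\<^esub> x) = x \<squnion>\<^bsub>S\<^esub> y"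
    if "x \<in> carrier S" "y \<in> carrier S" for x y
    using that right_meet[of x y] right_join[of x y] by (simp_all add: meet_assoc join_assoc)
  \<comment> \<open>The opposite algebra has the two parts of \<open>x\<close> joined in the other order.\<close>
  have b: "(x \<setminus>\<^bsub>S\<^esub> y) \<squnion>\<^bsub>S\<^esub> (x \<sqinter>\<^bsub>S\<^esub> (y \<sqinter>\<^bsub>S\<^esub> x)) = x"
      "(x \<setminus>\<^bsub>S\<^esub> y) \<sqinter>\<^bsub>S\<^esub> (x \<sqinter>\<^bsub>S\<^esub> (y \<sqinter>\<^bsub>S\<^esub> x)) = \<zero>\<^bsub>S\<^esub>"
      "(x \<sqinter>\<^bsub>S\<^esub> (y \<sqinter>\<^bsub>S\<^esub> x)) \<sqinter>\<^bsub>S\<^esub> (x \<setminus>\<^bsub>S\<^esub> y) = \<zero>\<^bsub>S\<^esub>"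
    if "x \<in> carrier S" "y \<in> carrier S" for x y
    using that diff_join_meet[of x y] diff_meet_meet[of x y] meet_meet_diff[of x y]
    by (simp_all add: meet_assoc)
  show ?thesis
    apply unfold_locales
    subgoal by simp
    subgoal by simp
    subgoal by simp
    subgoal by simp
    subgoal by (simp add: meet_assoc)
    subgoal by (simp add: join_assoc)
    subgoal by (simp add: join_meet_absorb')
    subgoal by (simp add: meet_join_absorb)
    subgoal by (simp add: meet_join_absorb')
    subgoal by (simp add: join_meet_absorb)
    subgoal by (simp add: join_meet_distrib)
    subgoal by (simp add: meet_join_distrib)
    subgoal by simp
    subgoal by simp
    subgoal by simp
    subgoal by simp
    subgoal by (simp add: b)
    subgoal by (simp add: b)
    subgoal by (simp add: b)
    subgoal by (simp add: a)
    subgoal by (simp add: a)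
    done
qed

lemma right_handed_sba_opposite_flat_left: "right_handed_sba (opposite flat_left)"
  by unfold_locales (simp_all add: flat_left_def opposite_def del: not_None_eq)

section \<open>The free algebras on \<open>n\<close> generators\<close>

lemma free_algebra_induct:
  fixes V :: "'v sba_term set sba \<Rightarrow> bool"
  assumes c: "sba_congruence (term_algebra X) (free_congruence V X)"
    and C: "C \<in> carrier (free_algebra V X)"
    and gen: "\<And>v. v \<in> X \<Longrightarrow> P (free_gen V X v)"

      and zero: "P (zero (free_algebra V X))"
    and step: "\<And>C D. \<lbrakk>C \<in> carrier (free_algebra V X); D \<in> carrier (free_algebra V X); P C; P D\<rbrakk>
      \<Longrightarrow> P (meet (free_algebra V X) C D) \<and> P (join (free_algebra V X) C D) \<and>
          P (diff (free_algebra V X) C D)"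
  shows "P C"
proof -
  let ?\<phi> = "free_congruence V X" and ?T = "term_algebra X" and ?F = "free_algebra V X"
  note T = term_algebra_def[of X]
  have F: "carrier ?F = carrier ?T // ?\<phi>" "zero ?F = ?\<phi> `` {Zero}"
    by (simp_all add: free_algebra_def sba_quotient_def T)
  note ops = sba_quotient_ops[OF c, folded free_algebra_def]
  have 2: "P (?\<phi> `` {Meet s t}) \<and> P (?\<phi> `` {Join s t}) \<and> P (?\<phi> `` {Diff s t})"
    if "s \<in> carrier ?T" "t \<in> carrier ?T" "P (?\<phi> `` {s})" "P (?\<phi> `` {t})" for s t
    using step[of "?\<phi> `` {s}" "?\<phi> `` {t}"] that ops[of s t] by (simp add: F quotientI) (simp add: T)
  have "P (?\<phi> `` {t})" if "t \<in> carrier ?T" for t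
    using that
  proof (induction t)
    case (Var v)
    then show ?case using gen[of v] by (simp add: T free_gen_def)
  next
    case Zero
    then show ?case using zero by (simp add: F)
  qed (use 2 in \<open>simp_all add: T\<close>)
  then show ?thesis
    using C by (auto simp: F elim!: quotientE)
qed

lemma free_gen_carrier:
  assumes "sba_congruence (term_algebra X) (free_congruence V X)"
  shows "free_gen V X ` X \<subseteq> carrier (free_algebra V X)"
  by (auto simp: free_gen_def free_algebra_def sba_quotient_def term_algebra_def intro!: quotientI)

lemma LSBA_finitely_generated_free: "finitely_generated_free_left (LSBA n) (LSBA_gens n)"
proof -
  have c: "sba_congruence (term_algebra X) (free_congruence left_handed_sba X)" for X :: "nat set"
    by (rule free_congruence_congruence) (rule left_handed_sba_separated)
  show ?thesis
  proof (intro finitely_generated_free_left.intro finitely_generated_free_left_axioms.intro)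
    show "left_handed_sba (LSBA n)"
      unfolding LSBA_def by (rule left_handed_sba_free_algebra)
    show "finite (LSBA_gens n)" "LSBA_gens n \<subseteq> carrier (LSBA n)"
      using free_gen_carrier[OF c] by (simp_all add: LSBA_gens_def LSBA_def)
  next
    fix C P
    assume C: "C \<in> carrier (LSBA n)" and gen: "\<And>g. g \<in> LSBA_gens n \<Longrightarrow> P g"
      and zero: "P (zero (LSBA n))"
      and ops:
      "\<And>x y. \<lbrakk>x \<in> carrier (LSBA n); y \<in> carrier (LSBA n); P x; P y\<rbrakk> \<Longrightarrow> P (meet (LSBA n) x y)"
      "\<And>x y. \<lbrakk>x \<in> carrier (LSBA n); y \<in> carrier (LSBA n); P x; P y\<rbrakk> \<Longrightarrow> P (join (LSBA n) x y)"
      "\<And>x y. \<lbrakk>x \<in> carrier (LSBA n); y \<in> carrier (LSBA n); P x; P y\<rbrakk> \<Longrightarrow> P (diff (LSBA n) x y)"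
    show "P C"
    proof (rule free_algebra_induct[OF c[of "{1..n}"], folded LSBA_def])
      show "P (free_gen left_handed_sba {1..n} v)" if "v \<in> {1..n}" for v
        using gen that by (simp add: LSBA_gens_def)
    qed (use C zero ops in simp_all)
  next
    fix f :: "nat sba_term set \<Rightarrow> nat sba_term set option"
    let ?g = "free_gen left_handed_sba {1..n}"
    have "\<exists>h \<in> sba_hom (LSBA n) flat_left. \<forall>v\<in>{1..n}. h (?g v) = f (?g v)"
      using left_handed_universal_property[OF left_handed_sba_flat_left, of "{1..n}" "f \<circ> ?g"]
      unfolding LSBA_def by (auto simp: flat_left_def)
    then show "\<exists>h \<in> sba_hom (LSBA n) flat_left. \<forall>g\<in>LSBA_gens n. h g = f g"
      by (auto simp: LSBA_gens_def)
  qed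
qed

text \<open>
  A homomorphism from the opposite algebra to the flat algebra is the same as one from the algebra
  itself to the opposite of the flat algebra, which is right-handed.
\<close>
lemma RSBA_finitely_generated_free:
  "finitely_generated_free_left (opposite (RSBA n)) (RSBA_gens n)"
proof -
  have c: "sba_congruence (term_algebra X) (free_congruence right_handed_sba X)" for X :: "nat set"
    by (rule free_congruence_congruence) (rule right_handed_sba_separated)
  show ?thesis
  proof (intro finitely_generated_free_left.intro finitely_generated_free_left_axioms.intro)
    show "left_handed_sba (opposite (RSBA n))"
      unfolding RSBA_def by (intro left_handed_sba_opposite right_handed_sba_free_algebra)
    show "finite (RSBA_gens n)" "RSBA_gens n \<subseteq> carrier (opposite (RSBA n))"
      using free_gen_carrier[OF c] by (simp_all add: RSBA_gens_def RSBA_def)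
  next
    fix C P
    let ?R = "opposite (RSBA n)"
    assume C: "C \<in> carrier ?R" and gen: "\<And>g. g \<in> RSBA_gens n \<Longrightarrow> P g"
      and zero: "P (zero ?R)"
      and ops:
      "\<And>x y. \<lbrakk>x \<in> carrier ?R; y \<in> carrier ?R; P x; P y\<rbrakk> \<Longrightarrow> P (meet ?R x y)"
      "\<And>x y. \<lbrakk>x \<in> carrier ?R; y \<in> carrier ?R; P x; P y\<rbrakk> \<Longrightarrow> P (join ?R x y)"
      "\<And>x y. \<lbrakk>x \<in> carrier ?R; y \<in> carrier ?R; P x; P y\<rbrakk> \<Longrightarrow> P (diff ?R x y)"
    show "P C"
    proof (rule free_algebra_induct[OF c[of "{1..n}"], folded RSBA_def])
      show "P (free_gen right_handed_sba {1..n} v)" if "v \<in> {1..n}" for v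
        using gen that by (simp add: RSBA_gens_def)
    qed (use C zero ops in simp_all)
  next
    fix f :: "nat sba_term set \<Rightarrow> nat sba_term set option"
    let ?g = "free_gen right_handed_sba {1..n}"
    have "\<exists>h \<in> sba_hom (RSBA n) (opposite flat_left). \<forall>v\<in>{1..n}. h (?g v) = f (?g v)"
      using right_handed_universal_property[OF right_handed_sba_opposite_flat_left,
          of "{1..n}" "f \<circ> ?g"]
      unfolding RSBA_def by (auto simp: flat_left_def)
    then show "\<exists>h \<in> sba_hom (opposite (RSBA n)) flat_left. \<forall>g\<in>RSBA_gens n. h g = f g"
      by (auto simp: RSBA_gens_def sba_hom_opposite)
  qed
qed

text \<open>
  Distinct variables stay distinct in the free algebra, so its arrangements of generators have length
  \<open>n\<close>.
\<close>
lemma card_LSBA_gens: "card (LSBA_gens n) = n"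
  unfolding LSBA_gens_def by (simp add: card_image inj_on_free_gen_left)

lemma card_RSBA_gens: "card (RSBA_gens n) = n"
  unfolding RSBA_gens_def by (simp add: card_image inj_on_free_gen_right)

lemma LSBA_structure:
  fixes n
  defines "S \<equiv> LSBA n" and "perms \<equiv> permutations_of_set (LSBA_gens n)"
  shows "finite (carrier S)"
    and "sba_atoms S = {atom_term S ys k | ys k. ys \<in> perms \<and> k \<in> {1..n}}"
    and "\<lbrakk>ys \<in> perms; zs \<in> perms; k \<in> {1..n}; l \<in> {1..n}\<rbrakk> \<Longrightarrow>
      (\<exists>C \<in> atomic_D_classes S. atom_term S ys k \<in> C \<and> atom_term S zs l \<in> C) \<longleftrightarrow>
      k = l \<and> take k zs \<in> permutations_of_set (set (take k ys))"
    and "\<lbrakk>ys \<in> perms; zs \<in> perms; k \<in> {1..n}; take k zs \<in> permutations_of_set (set (take k ys));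
        hd ys = hd zs\<rbrakk> \<Longrightarrow> atom_term S ys k = atom_term S zs k"
proof -
  interpret finitely_generated_free_left S "LSBA_gens n"
    unfolding S_def by (rule LSBA_finitely_generated_free)
  have len: "length ys = n" if "ys \<in> perms" for ys
    using that by (simp add: perms_def length_finite_permutations_of_set card_LSBA_gens)
  show "finite (carrier S)"
    by (rule finite_carrier)
  show "sba_atoms S = {atom_term S ys k | ys k. ys \<in> perms \<and> k \<in> {1..n}}"
    using atoms_eq_atom_terms by (simp add: perms_def card_LSBA_gens)
  show "(\<exists>C \<in> atomic_D_classes S. atom_term S ys k \<in> C \<and> atom_term S zs l \<in> C) \<longleftrightarrow>
      k = l \<and> take k zs \<in> permutations_of_set (set (take k ys))"
    if "ys \<in> perms" "zs \<in> perms" "k \<in> {1..n}" "l \<in> {1..n}"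
  proof -
    have "(\<exists>C \<in> atomic_D_classes S. atom_term S ys k \<in> C \<and> atom_term S zs l \<in> C) \<longleftrightarrow>
        set (take k ys) = set (take l zs)"
      using that by (intro same_atomic_D_class_atom_terms) (simp_all add: perms_def card_LSBA_gens)
    also have "\<dots> \<longleftrightarrow> k = l \<and> take k zs \<in> permutations_of_set (set (take k ys))"
      using that len by (intro set_take_eq_iff_permutation) (auto simp: perms_def)
    finally show ?thesis .
  qed
  show "atom_term S ys k = atom_term S zs k"
    if "ys \<in> perms" "zs \<in> perms" "k \<in> {1..n}" "take k zs \<in> permutations_of_set (set (take k ys))"
      "hd ys = hd zs"
    using that len by (intro atom_term_eqI) (auto simp: perms_def permutations_of_set_def)
qed

lemma RSBA_structure:
  fixes n
  defines "S \<equiv> RSBA n" and "perms \<equiv> permutations_of_set (RSBA_gens n)"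
  shows "finite (carrier S)"
    and "sba_atoms S = {atom_term S ys k | ys k. ys \<in> perms \<and> k \<in> {1..n}}"
    and "\<lbrakk>ys \<in> perms; zs \<in> perms; k \<in> {1..n}; l \<in> {1..n}\<rbrakk> \<Longrightarrow>
      (\<exists>C \<in> atomic_D_classes S. atom_term S ys k \<in> C \<and> atom_term S zs l \<in> C) \<longleftrightarrow>
      k = l \<and> take k zs \<in> permutations_of_set (set (take k ys))"
    and "\<lbrakk>ys \<in> perms; zs \<in> perms; k \<in> {1..n}; take k zs \<in> permutations_of_set (set (take k ys));
        ys ! (k - 1) = zs ! (k - 1)\<rbrakk> \<Longrightarrow> atom_term S ys k = atom_term S zs k"
proof -
  interpret op: finitely_generated_free_left "opposite S" "RSBA_gens n"
    unfolding S_def by (rule RSBA_finitely_generated_free)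
  interpret right_handed_sba S
    unfolding S_def RSBA_def by (rule right_handed_sba_free_algebra)
  have len: "length ys = n" if "ys \<in> perms" for ys
    using that by (simp add: perms_def length_finite_permutations_of_set card_RSBA_gens)
  have rev: "rev_blocks k ys \<in> perms" if "ys \<in> perms" for k ys
    using that by (simp add: perms_def rev_blocks_permutation)
  have atom: "atom_term S ys k = atom_term (opposite S) (rev_blocks k ys) k"
    if "ys \<in> perms" "k \<in> {1..n}" for ys k
    using that len[of ys] op.gens_carrier
    by (intro atom_term_opposite[symmetric]) (auto simp: perms_def permutations_of_set_def)
  show "finite (carrier S)"
    using op.finite_carrier by simp
  show "sba_atoms S = {atom_term S ys k | ys k. ys \<in> perms \<and> k \<in> {1..n}}"
  proof -
    have "sba_atoms S = {atom_term (opposite S) ys k | ys k. ys \<in> perms \<and> k \<in> {1..n}}"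
      using op.atoms_eq_atom_terms by (simp add: sba_atoms_opposite perms_def card_RSBA_gens)
    also have "\<dots> = {atom_term S ys k | ys k. ys \<in> perms \<and> k \<in> {1..n}}"
    proof (intro equalityI subsetI; elim CollectE exE conjE)
      \<comment> \<open>Reversal of the blocks is an involution on arrangements, so both sides range over the same terms.\<close>
      fix a ys k assume "a = atom_term (opposite S) ys k" "ys \<in> perms" "k \<in> {1..n}"
      then show "a \<in> {atom_term S ys k | ys k. ys \<in> perms \<and> k \<in> {1..n}}"
        using len[of ys]
        by (intro CollectI exI[of _ "rev_blocks k ys"] exI[of _ k])
           (simp add: atom rev rev_blocks_rev_blocks)
    next
      fix a ys k assume "a = atom_term S ys k" "ys \<in> perms" "k \<in> {1..n}"
      then show "a \<in> {atom_term (opposite S) ys k | ys k. ys \<in> perms \<and> k \<in> {1..n}}"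
        by (intro CollectI exI[of _ "rev_blocks k ys"] exI[of _ k]) (simp add: atom rev)
    qed
    finally show ?thesis .
  qed
  show "(\<exists>C \<in> atomic_D_classes S. atom_term S ys k \<in> C \<and> atom_term S zs l \<in> C) \<longleftrightarrow>
      k = l \<and> take k zs \<in> permutations_of_set (set (take k ys))"
    if "ys \<in> perms" "zs \<in> perms" "k \<in> {1..n}" "l \<in> {1..n}"
  proof -
    have "(\<exists>C \<in> atomic_D_classes S. atom_term S ys k \<in> C \<and> atom_term S zs l \<in> C) \<longleftrightarrow>
        set (take k (rev_blocks k ys)) = set (take l (rev_blocks l zs))"
      using that op.same_atomic_D_class_atom_terms[of "rev_blocks k ys" k "rev_blocks l zs" l]
        rev[of ys k] rev[of zs l]
      by (simp add: atom atomic_D_classes_opposite perms_def card_RSBA_gens)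
    also have "\<dots> \<longleftrightarrow> set (take k ys) = set (take l zs)"
      using that len by (simp add: rev_blocks_simps)
    also have "\<dots> \<longleftrightarrow> k = l \<and> take k zs \<in> permutations_of_set (set (take k ys))"
      using that len by (intro set_take_eq_iff_permutation) (auto simp: perms_def)
    finally show ?thesis .
  qed
  show "atom_term S ys k = atom_term S zs k"
    if "ys \<in> perms" "zs \<in> perms" "k \<in> {1..n}" "take k zs \<in> permutations_of_set (set (take k ys))"
      "ys ! (k - 1) = zs ! (k - 1)"
  proof -
    have "atom_term (opposite S) (rev_blocks k ys) k = atom_term (opposite S) (rev_blocks k zs) k"
    proof (rule op.atom_term_eqI)
      show "hd (rev_blocks k ys) = hd (rev_blocks k zs)"
        using that len by (simp add: hd_rev_blocks)
      show "set (take k (rev_blocks k ys)) = set (take k (rev_blocks k zs))"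
        using that len by (simp add: rev_blocks_simps permutations_of_set_def)
    qed (use that len rev in \<open>auto simp: perms_def\<close>)
    then show ?thesis
      using that by (simp add: atom)
  qed
qed

theorem theorem4p2:
  fixes n :: nat
  assumes "n \<ge> 1"
  shows
    "\<comment> \<open>left-handed (i)\<close>
     finite (carrier (LSBA n)) \<and>
     sba_atoms (LSBA n) =
       {atom_term (LSBA n) ys k | ys k. ys \<in> permutations_of_set (LSBA_gens n) \<and> k \<in> {1..n}} \<and>
     \<comment> \<open>left-handed (ii)\<close>
     (\<forall>ys \<in> permutations_of_set (LSBA_gens n). \<forall>zs \<in> permutations_of_set (LSBA_gens n).
      \<forall>k \<in> {1..n}. \<forall>l \<in> {1..n}.
        ((\<exists>C \<in> atomic_D_classes (LSBA n).
            atom_term (LSBA n) ys k \<in> C \<and> atom_term (LSBA n) zs l \<in> C) \<longleftrightarrow>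
         k = l \<and> take k zs \<in> permutations_of_set (set (take k ys))) \<and>
        (k = l \<and> take k zs \<in> permutations_of_set (set (take k ys)) \<longrightarrow>
         drop l zs \<in> permutations_of_set (set (drop k ys)))) \<and>
     \<comment> \<open>left-handed (iii)\<close>
     (\<forall>ys \<in> permutations_of_set (LSBA_gens n). \<forall>zs \<in> permutations_of_set (LSBA_gens n).
      \<forall>k \<in> {1..n}. \<forall>l \<in> {1..n}.
        k = l \<and> take k zs \<in> permutations_of_set (set (take k ys)) \<and> hd ys = hd zs \<longrightarrow>
        atom_term (LSBA n) ys k = atom_term (LSBA n) zs l) \<and>
     \<comment> \<open>right-handed (i)\<close>
     finite (carrier (RSBA n)) \<and>
     sba_atoms (RSBA n) =
       {atom_term (RSBA n) ys k | ys k. ys \<in> permutations_of_set (RSBA_gens n) \<and> k \<in> {1..n}} \<and>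
     \<comment> \<open>right-handed (ii)\<close>
     (\<forall>ys \<in> permutations_of_set (RSBA_gens n). \<forall>zs \<in> permutations_of_set (RSBA_gens n).
      \<forall>k \<in> {1..n}. \<forall>l \<in> {1..n}.
        ((\<exists>C \<in> atomic_D_classes (RSBA n).
            atom_term (RSBA n) ys k \<in> C \<and> atom_term (RSBA n) zs l \<in> C) \<longleftrightarrow>
         k = l \<and> take k zs \<in> permutations_of_set (set (take k ys))) \<and>
        (k = l \<and> take k zs \<in> permutations_of_set (set (take k ys)) \<longrightarrow>
         drop l zs \<in> permutations_of_set (set (drop k ys)))) \<and>
     \<comment> \<open>right-handed (iii)\<close>
     (\<forall>ys \<in> permutations_of_set (RSBA_gens n). \<forall>zs \<in> permutations_of_set (RSBA_gens n).
      \<forall>k \<in> {1..n}. \<forall>l \<in> {1..n}.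
        k = l \<and> take k zs \<in> permutations_of_set (set (take k ys)) \<and>
        ys ! (k - 1) = zs ! (k - 1) \<longrightarrow>
        atom_term (RSBA n) ys k = atom_term (RSBA n) zs l)"
  by (intro conjI ballI impI; (elim conjE)?; hypsubst?;
      rule LSBA_structure RSBA_structure drop_permutation_of_take_permutation; assumption)

end
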